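(* Let $n\ge 2$ and let $\{1,\dots,n\}=C\,\dot\cup\,D$ be a partition with $|C|=m\ge 1$ and $|D|=n-m\ge 1$. Let $S\in\mathbb{C}^{n\times n}$ be such that $S_{DD}$ is invertible, $\xi\in\mathbb{R}$ with $\xi\neq 0$, $P=\mathrm{diag}(\mathbf 1_{i\in C})$, and let $\widehat K\in\mathbb{C}^{n\times n}$ be Hermitian positive definite; all of these are fixed independently of $b$. For $b>0$ set $\widehat A=S+ib\xi P$ and $\widehat G=\widehat A\,\widehat K\,\widehat A^{\mathsf H}$. Let $\rho=\bigl\|\widehat K_{CC}^{-1/2}\widehat K_{CD}\widehat K_{DD}^{-1/2}\bigr\|_2<1$ and $\Lambda=\lambda_{\min}\bigl(S_{DD}\widehat K_{DD}S_{DD}^{\mathsf H}\bigr)$. Then, as $b\to\infty$, $$\frac{\lambda_{\max}(\widehat K_{CC})\,b^{2}\xi^{2}}{\Lambda}\,\bigl(1+o(1)\bigr)\le\kappa(\widehat G)\le\frac{\lambda_{\max}(\widehat K_{CC})\,b^{2}\xi^{2}}{(1-\rho^{2})\,\Lambda}\,\bigl(1+o(1)\bigr),$$ that is, $\mathrm{Pe}^{2}\lesssim\kappa(\widehat G)\lesssim\dfrac{\mathrm{Pe}^{2}}{1-\rho^{2}}$ with $\mathrm{Pe}=\dfrac{b}{\varepsilon_D\,\xi}$.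
   Context: $M^{\mathsf H}$ denotes the conjugate transpose; $\|\cdot\|_2$ the spectral norm; $\lambda_{\min},\lambda_{\max}$ the smallest and largest eigenvalues of a Hermitian matrix; $\kappa(M)=\lambda_{\max}(M)/\lambda_{\min}(M)$ is the spectral condition number of a Hermitian positive definite matrix. For $M\in\mathbb{C}^{n\times n}$ and the partition $\{1,\dots,n\}=C\,\dot\cup\,D$, the blocks of $M$ are denoted $M_{CC}$, $M_{CD}$, $M_{DC}$, $M_{DD}$. The P\'eclet number is $\mathrm{Pe}=b/(\varepsilon_D\xi)$, where $\varepsilon_D=\min_{i\in D}\varepsilon_i$ and $\varepsilon_1,\dots,\varepsilon_n>0$ are the fixed diffusion coefficients of the underlying system. The notation $X\lesssim Y$ means $X\le cY$ for all sufficiently large $b$, with a constant $c>0$ independent of $b$. *)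

theory Defs
  imports
    "Jordan_Normal_Form.Spectral_Radius"
    "Jordan_Normal_Form.DL_Submatrix"
    "HOL-Analysis.L2_Norm"
    "HOL-Library.Landau_Symbols"
begin

text \<open>Matrices are the \<open>n \<times> n\<close> matrices of \<^typ>\<open>complex mat\<close>; their index set is
  \<open>{0..<n}\<close>, and the block \<open>M\<^sub>C\<^sub>D\<close> is \<^term>\<open>submatrix M C D\<close>, whose rows and columns are
  in increasing order of the original indices.\<close>

definition hermitian_mat :: "complex mat \<Rightarrow> bool" where
  "hermitian_mat M \<longleftrightarrow> square_mat M \<and> mat_adjoint M = M"

text \<open>\<^term>\<open>(M *\<^sub>v v) \<bullet>c v\<close> is \<open>v\<^sup>H M v\<close>, which is real when \<open>M\<close> is Hermitian.\<close>

definition hpd_mat :: "complex mat \<Rightarrow> bool" where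
  "hpd_mat M \<longleftrightarrow> hermitian_mat M \<and>
     (\<forall>v \<in> carrier_vec (dim_row M). v \<noteq> 0\<^sub>v (dim_row M) \<longrightarrow> Re ((M *\<^sub>v v) \<bullet>c v) > 0)"

text \<open>The eigenvalues of a Hermitian matrix are real and finite in number. The next three
  definitions are meant for Hermitian matrices of dimension at least one.\<close>

definition lambda_min :: "complex mat \<Rightarrow> real" where
  "lambda_min M = Min {x. eigenvalue M (complex_of_real x)}"

definition lambda_max :: "complex mat \<Rightarrow> real" where
  "lambda_max M = Max {x. eigenvalue M (complex_of_real x)}"

definition spectral_cond :: "complex mat \<Rightarrow> real" where
  "spectral_cond M = lambda_max M / lambda_min M"

definition l2_norm_vec :: "complex vec \<Rightarrow> real" where
  "l2_norm_vec v = L2_set (\<lambda>i. cmod (v $ i)) {0..<dim_vec v}"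

text \<open>The spectral norm is the operator norm induced by the Euclidean norm.\<close>

definition spectral_norm :: "complex mat \<Rightarrow> real" where
  "spectral_norm M =
     Sup {l2_norm_vec (M *\<^sub>v v) | v. v \<in> carrier_vec (dim_col M) \<and> l2_norm_vec v = 1}"

text \<open>A Hermitian positive definite matrix \<open>M\<close> has a unique Hermitian positive definite
  square root.\<close>

definition mat_sqrt :: "complex mat \<Rightarrow> complex mat" where
  "mat_sqrt M = (THE R. hpd_mat R \<and> R * R = M)"

definition mat_inv_sqrt :: "complex mat \<Rightarrow> complex mat" where
  "mat_inv_sqrt M = the (mat_inverse (mat_sqrt M))"

definition peclet :: "real \<Rightarrow> real \<Rightarrow> real \<Rightarrow> real" where
  "peclet b eps_D xi = b / (eps_D * xi)"

definition lesssim :: "(real \<Rightarrow> real) \<Rightarrow> (real \<Rightarrow> real) \<Rightarrow> bool" (infix "\<lesssim>" 50) where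
  "X \<lesssim> Y \<longleftrightarrow> (\<exists>c>0. \<forall>\<^sub>F b in at_top. X b \<le> c * Y b)"

end

theory Submission
  imports Defs "HOL-Real_Asymp.Real_Asymp"
begin

text \<open>Write \<open>N w\<close> for the energy norm \<open>sqrt (w\<^sup>H K w)\<close>, so that \<open>v\<^sup>H G(b) v = N (A(b)\<^sup>H v)\<^sup>2\<close> and the
extreme eigenvalues of \<open>G(b)\<close> are the extreme values of \<open>N (A(b)\<^sup>H v)\<^sup>2\<close> over unit vectors \<open>v\<close>.
Since \<open>A(b)\<^sup>H v = S\<^sup>H v - i b \<xi> P v\<close>, the triangle inequality for \<open>N\<close> decides everything, and all
errors come out relatively of size \<open>1/b\<close>.

At the top of the spectrum the term \<open>b \<xi> P v\<close> dominates, and the largest value of \<open>N (P v)\<close> is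
the square root of \<open>\<lambda>\<^sub>m\<^sub>a\<^sub>x(K\<^sub>C\<^sub>C)\<close> (\<open>lambda_max_G_bounds\<close>).

At the bottom, a vector with small energy must have \<open>v\<^sub>C = O(1/b)\<close>; then the \<open>D\<close> component of
\<open>A(b)\<^sup>H v\<close> is \<open>S\<^sub>D\<^sub>D\<^sup>H v\<^sub>D\<close> up to \<open>O(1/b)\<close>, whereas its \<open>C\<close> component is arbitrary, because
\<open>b \<xi> v\<^sub>C\<close> may be any vector of order one. Cancelling the \<open>C\<close> component by such a choice of \<open>v\<^sub>C\<close>
leaves, for a suitable \<open>v\<^sub>D\<close>, an energy that tends to \<open>\<Lambda>\<close> (\<open>lambda_min_G_upper\<close>). Conversely, minimising over the \<open>C\<close> component
produces the Schur complement of \<open>K\<^sub>C\<^sub>C\<close>, which is at least \<open>1 - \<rho>\<^sup>2\<close> times \<open>K\<^sub>D\<^sub>D\<close>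
(\<open>block_contraction\<close>), whence \<open>\<lambda>\<^sub>m\<^sub>i\<^sub>n(G(b)) \<ge> (1 - \<rho>\<^sup>2) \<Lambda> (1 - O(1/b))\<close>
(\<open>lambda_min_G_lower\<close>). Dividing the two estimates gives the asymptotics of the condition number, and
the Peclet form only rescales \<open>b\<close>.

The matrix analysis that supports this is the spectral theorem for Hermitian matrices, proved by
deflation with Householder reflections (\<open>hermitian_spectral\<close>). It yields Rayleigh's
characterisation of the extreme eigenvalues and the existence and uniqueness of positive definite
square roots. Blocks of a matrix are treated without indices, as compressions \<open>E\<^sub>I\<^sup>H M E\<^sub>J\<close> by
coordinate inclusions.\<close>

section \<open>Adjoints, inner product and Euclidean norm\<close>

lemma mat_adjoint_dim [simp]:
  "dim_row (mat_adjoint A) = dim_col A" "dim_col (mat_adjoint A) = dim_row A"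
  by (simp_all add: mat_adjoint_def)

lemma mat_adjoint_carrier [simp]: "A \<in> carrier_mat nr nc \<Longrightarrow> mat_adjoint A \<in> carrier_mat nc nr"
  by (metis carrier_matD carrier_matI mat_adjoint_dim)

lemma mat_adjoint_index [simp]:
  fixes A :: "complex mat"
  assumes "i < dim_col A" "j < dim_row A"
  shows "mat_adjoint A $$ (i, j) = cnj (A $$ (j, i))"
  using assms by (simp add: mat_adjoint_def mat_of_rows_index)

lemma mat_adjoint_adjoint [simp]: "mat_adjoint (mat_adjoint A) = (A :: complex mat)"
  by (rule eq_matI) auto

lemma mat_adjoint_mult:
  fixes A B :: "complex mat"
  assumes "A \<in> carrier_mat n k" "B \<in> carrier_mat k m"
  shows "mat_adjoint (A * B) = mat_adjoint B * mat_adjoint A"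
  by (rule eq_matI) (use assms in \<open>auto simp: scalar_prod_def mult.commute intro!: sum.cong\<close>)

lemma mat_adjoint_add:
  fixes A B :: "complex mat"
  assumes "A \<in> carrier_mat n m" "B \<in> carrier_mat n m"
  shows "mat_adjoint (A + B) = mat_adjoint A + mat_adjoint B"
  by (rule eq_matI) (use assms in auto)

lemma mat_adjoint_smult:
  fixes A :: "complex mat"
  shows "mat_adjoint (c \<cdot>\<^sub>m A) = cnj c \<cdot>\<^sub>m mat_adjoint A"
  by (rule eq_matI) auto

lemma mat_adjoint_one [simp]: "mat_adjoint (1\<^sub>m n :: complex mat) = 1\<^sub>m n"
  by (rule eq_matI) auto

lemma mat_adjoint_diag: "mat_adjoint (mat_diag n d :: complex mat) = mat_diag n (\<lambda>i. cnj (d i))"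
  by (rule eq_matI) (auto simp: mat_diag_def)

lemma inner_adjoint:
  fixes A :: "complex mat"
  assumes A: "A \<in> carrier_mat n m" and v: "v \<in> carrier_vec m" and w: "w \<in> carrier_vec n"
  shows "(A *\<^sub>v v) \<bullet>c w = v \<bullet>c (mat_adjoint A *\<^sub>v w)"
proof -
  have "(A *\<^sub>v v) \<bullet>c w = (\<Sum>i<n. \<Sum>j<m. A $$ (i, j) * v $ j * cnj (w $ i))"
    using A v w by (simp add: scalar_prod_def sum_distrib_right atLeast0LessThan)
  also have "\<dots> = (\<Sum>j<m. \<Sum>i<n. A $$ (i, j) * v $ j * cnj (w $ i))"
    by (rule sum.swap)
  also have "\<dots> = v \<bullet>c (mat_adjoint A *\<^sub>v w)"
    using A v w by (simp add: scalar_prod_def sum_distrib_left atLeast0LessThan mult_ac)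
  finally show ?thesis .
qed

text \<open>The side conditions of the next four lemmas are equations between dimensions, which the simplifier
can check; conditions on carriers would leave it to guess the inner dimension.\<close>
lemma mult_mat_vec_assoc:
  fixes A B :: "complex mat"
  shows "dim_col A = dim_row B \<Longrightarrow> dim_vec v = dim_col B \<Longrightarrow> A * B *\<^sub>v v = A *\<^sub>v (B *\<^sub>v v)"
  by (rule assoc_mult_mat_vec) (auto intro: carrier_matI carrier_vecI)

lemma mult_mat_assoc:
  fixes A B C :: "complex mat"
  shows "dim_col A = dim_row B \<Longrightarrow> dim_col B = dim_row C \<Longrightarrow> A * B * C = A * (B * C)"
  by (rule assoc_mult_mat) (auto intro: carrier_matI)

lemma mult_mat_vec_smult:
  fixes A :: "complex mat"
  shows "dim_vec v = dim_col A \<Longrightarrow> A *\<^sub>v (c \<cdot>\<^sub>v v) = c \<cdot>\<^sub>v (A *\<^sub>v v)"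
  by (rule mult_mat_vec) (auto intro: carrier_matI carrier_vecI)

lemma mult_mat_vec_add:
  fixes A :: "complex mat"
  shows "dim_vec v = dim_col A \<Longrightarrow> dim_vec w = dim_col A \<Longrightarrow> A *\<^sub>v (v + w) = A *\<^sub>v v + A *\<^sub>v w"
  by (rule mult_add_distrib_mat_vec) (auto intro: carrier_matI carrier_vecI)

lemma inner_commute:
  fixes v w :: "complex vec"
  assumes "v \<in> carrier_vec n" "w \<in> carrier_vec n"
  shows "v \<bullet>c w = cnj (w \<bullet>c v)"
  using assms by (simp add: scalar_prod_def mult.commute)

lemma l2_norm_vec_nonneg [simp]: "0 \<le> l2_norm_vec v"
  by (simp add: l2_norm_vec_def L2_set_nonneg)

lemma inner_self: "v \<bullet>c v = complex_of_real ((l2_norm_vec v)\<^sup>2)"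
proof -
  have "(l2_norm_vec v)\<^sup>2 = (\<Sum>i = 0..<dim_vec v. (cmod (v $ i))\<^sup>2)"
    by (simp add: l2_norm_vec_def L2_set_def sum_nonneg)
  then show ?thesis by (simp add: scalar_prod_def complex_norm_square del: of_real_power)
qed

lemma l2_norm_vec_sq: "(l2_norm_vec v)\<^sup>2 = Re (v \<bullet>c v)"
  by (simp add: inner_self)

lemma l2_norm_vec_eq_0:
  assumes "v \<in> carrier_vec n"
  shows "l2_norm_vec v = 0 \<longleftrightarrow> v = 0\<^sub>v n"
  using assms conjugate_square_eq_0_vec[of v n] by (simp add: inner_self)

lemma l2_norm_vec_zero [simp]: "l2_norm_vec (0\<^sub>v n) = 0"
  by (subst l2_norm_vec_eq_0[of _ n]) auto

lemma l2_norm_vec_smult: "l2_norm_vec (c \<cdot>\<^sub>v v) = cmod c * l2_norm_vec v"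
  by (simp add: l2_norm_vec_def L2_set_right_distrib norm_mult cong: L2_set_cong_simp)

lemma l2_norm_vec_triangle:
  assumes "v \<in> carrier_vec n" "w \<in> carrier_vec n"
  shows "l2_norm_vec (v + w) \<le> l2_norm_vec v + l2_norm_vec w"
proof -
  have "l2_norm_vec (v + w) \<le> L2_set (\<lambda>i. cmod (v $ i) + cmod (w $ i)) {0..<n}"
    using assms by (auto simp: l2_norm_vec_def intro!: L2_set_mono norm_triangle_ineq)
  also have "\<dots> \<le> l2_norm_vec v + l2_norm_vec w"
    using assms by (auto simp: l2_norm_vec_def intro!: L2_set_triangle_ineq)
  finally show ?thesis .
qed

lemma inner_le_norm:
  assumes "v \<in> carrier_vec n" "w \<in> carrier_vec n"
  shows "cmod (v \<bullet>c w) \<le> l2_norm_vec v * l2_norm_vec w"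
proof -
  have "cmod (v \<bullet>c w) \<le> (\<Sum>i = 0..<n. cmod (v $ i) * cmod (w $ i))"
    using assms by (auto simp: scalar_prod_def norm_mult intro!: sum_norm_le)
  also have "\<dots> \<le> l2_norm_vec v * l2_norm_vec w"
    using assms L2_set_mult_ineq[of "\<lambda>i. cmod (v $ i)" "\<lambda>i. cmod (w $ i)" "{0..<n}"]
    by (auto simp: l2_norm_vec_def)
  finally show ?thesis .
qed

lemma l2_norm_vec_mult_adjoint:
  assumes "A \<in> carrier_mat n m" "v \<in> carrier_vec m"
  shows "(l2_norm_vec (A *\<^sub>v v))\<^sup>2 = Re ((mat_adjoint A * A *\<^sub>v v) \<bullet>c v)"
proof -
  define w where "w = mat_adjoint A *\<^sub>v (A *\<^sub>v v)"
  have w: "w \<in> carrier_vec m" using assms by (auto simp: w_def intro!: carrier_vecI)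
  have "(l2_norm_vec (A *\<^sub>v v))\<^sup>2 = Re (v \<bullet>c w)"
    using assms by (simp add: l2_norm_vec_sq inner_adjoint[of A n m] w_def)
  also have "\<dots> = Re (w \<bullet>c v)"
    by (simp add: inner_commute[OF assms(2) w])
  also have "w = mat_adjoint A * A *\<^sub>v v"
    using assms by (simp add: mult_mat_vec_assoc w_def)
  finally show ?thesis .
qed

lemma l2_norm_vec_isometry:
  assumes "A \<in> carrier_mat n m" "mat_adjoint A * A = 1\<^sub>m m" "v \<in> carrier_vec m"
  shows "l2_norm_vec (A *\<^sub>v v) = l2_norm_vec v"
proof -
  have "(l2_norm_vec (A *\<^sub>v v))\<^sup>2 = (l2_norm_vec v)\<^sup>2"
    using l2_norm_vec_mult_adjoint[of A n m v] assms by (simp add: l2_norm_vec_sq)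
  then show ?thesis by simp
qed

lemma ex_unit_multiple:
  assumes "v \<in> carrier_vec n" "v \<noteq> 0\<^sub>v n"
  obtains c where "l2_norm_vec (c \<cdot>\<^sub>v v) = 1" "c \<noteq> 0"
proof -
  have "l2_norm_vec v \<noteq> 0" using assms l2_norm_vec_eq_0 by blast
  then have "l2_norm_vec (complex_of_real (1 / l2_norm_vec v) \<cdot>\<^sub>v v) = 1"
    "complex_of_real (1 / l2_norm_vec v) \<noteq> 0"
    by (auto simp: l2_norm_vec_smult norm_divide)
  then show thesis using that by blast
qed

section \<open>The spectral theorem for Hermitian matrices\<close>

definition unitary_mat :: "nat \<Rightarrow> complex mat \<Rightarrow> bool" where
  "unitary_mat n U \<longleftrightarrow> U \<in> carrier_mat n n \<and> mat_adjoint U * U = 1\<^sub>m n \<and> U * mat_adjoint U = 1\<^sub>m n"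

text \<open>The Householder reflection in the direction \<open>u = v - e\<^sub>0\<close> maps \<open>e\<^sub>0\<close> to \<open>v\<close> exactly when
\<open>u\<^sup>H u = - 2 u\<^sup>H e\<^sub>0\<close>, which over the complex numbers means that \<open>v\<^sub>0\<close> is real.\<close>
lemma ex_unitary_col0:
  assumes v: "v \<in> carrier_vec n" and nv: "l2_norm_vec v = 1" and real: "v $ 0 = complex_of_real a"
    and n: "n > 0"
  shows "\<exists>H. unitary_mat n H \<and> mat_adjoint H = H \<and> col H 0 = v"
proof (cases "v = unit_vec n 0")
  case True
  then show ?thesis using n by (intro exI[of _ "1\<^sub>m n"]) (auto simp: unitary_mat_def)
next
  case False
  \<comment> \<open>half of the squared norm of \<open>u\<close>, so that the reflection is \<open>1 - u u\<^sup>H / r\<close>\<close>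
  define r where "r = 1 - a"
  define u where "u = v - unit_vec n 0"
  have uc: "u \<in> carrier_vec n" using v by (simp add: u_def)
  have vv: "(\<Sum>i<n. v $ i * cnj (v $ i)) = 1"
    using inner_self[of v] nv v by (simp add: scalar_prod_def atLeast0LessThan)
  have ui: "u $ i = v $ i - (if i = 0 then 1 else 0)" if "i < n" for i
    using that v by (auto simp: u_def)
  have uu: "(\<Sum>k<n. cnj (u $ k) * u $ k) = 2 * complex_of_real r"
  proof -
    have "(\<Sum>k<n. cnj (u $ k) * u $ k)
        = (\<Sum>k<n. v $ k * cnj (v $ k) + (if k = 0 then 1 - v $ 0 - cnj (v $ 0) else 0))"
      by (intro sum.cong) (auto simp: ui algebra_simps)
    also have "\<dots> = 1 + (1 - v $ 0 - cnj (v $ 0))"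
      using n by (simp add: sum.distrib vv)
    also have "\<dots> = 2 * complex_of_real r" by (simp add: real r_def)
    finally show ?thesis .
  qed
  have "r \<noteq> 0"
  proof
    assume "r = 0"
    then have "u \<bullet>c u = 0"
      using uu uc by (simp add: scalar_prod_def atLeast0LessThan mult.commute)
    then have "u = 0\<^sub>v n" using uc by simp
    then have "v $ i = unit_vec n 0 $ i" if "i < n" for i
      using that ui[OF that] by simp
    then have "v = unit_vec n 0" using v by (intro eq_vecI) auto
    with False show False by simp
  qed
  define H where "H = mat n n (\<lambda>(i, j). (if i = j then 1 else 0) - u $ i * cnj (u $ j) / complex_of_real r)"
  have H: "H \<in> carrier_mat n n" by (simp add: H_def)
  have adj: "mat_adjoint H = H"
    by (rule eq_matI) (auto simp: H_def mult.commute)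
  have HH: "H * H = 1\<^sub>m n"
  proof (rule eq_matI)
    fix i j assume "i < dim_row (1\<^sub>m n :: complex mat)" "j < dim_col (1\<^sub>m n :: complex mat)"
    then have ij: "i < n" "j < n" by auto
    let ?r = "complex_of_real r"
    let ?d = "\<lambda>i j :: nat. if i = j then 1 else (0::complex)"
    have "(H * H) $$ (i, j) = (\<Sum>k<n. (?d i k - u $ i * cnj (u $ k) / ?r) * (?d k j - u $ k * cnj (u $ j) / ?r))"
      using ij by (simp add: H_def scalar_prod_def atLeast0LessThan)
    also have "\<dots> = (\<Sum>k<n. (if k = i then ?d i j else 0) - (if k = i then u $ i * cnj (u $ j) / ?r else 0)
        - (if k = j then u $ i * cnj (u $ j) / ?r else 0)
        + (u $ i * cnj (u $ j) / (?r * ?r)) * (cnj (u $ k) * u $ k))"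
      by (intro sum.cong) (auto simp: algebra_simps)
    also have "\<dots> = ?d i j - u $ i * cnj (u $ j) / ?r - u $ i * cnj (u $ j) / ?r
        + (u $ i * cnj (u $ j) / (?r * ?r)) * (2 * ?r)"
      using ij unfolding sum.distrib sum_subtractf sum_distrib_left[symmetric] uu by simp
    also have "\<dots> = ?d i j" using \<open>r \<noteq> 0\<close> by simp
    finally show "(H * H) $$ (i, j) = 1\<^sub>m n $$ (i, j)" using ij by simp
  qed (auto simp: H_def)
  have "col H 0 = v"
  proof (rule eq_vecI)
    fix i assume "i < dim_vec v"
    then have i: "i < n" using v by simp
    have "cnj (u $ 0) = - complex_of_real r" using n by (simp add: ui real r_def)
    then have "col H 0 $ i = (if i = 0 then 1 else 0) + u $ i"
      using i n \<open>r \<noteq> 0\<close> by (simp add: H_def)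
    then show "col H 0 $ i = v $ i" using ui[OF i] by simp
  qed (use v in \<open>simp add: H_def\<close>)
  then show ?thesis using H adj HH by (auto simp: unitary_mat_def)
qed

lemma ex_eigenvector:
  fixes M :: "complex mat"
  assumes M: "M \<in> carrier_mat n n" and n: "n > 0"
  shows "\<exists>v l. eigenvector M v l"
proof -
  have "\<not> constant (poly (char_poly M))"
    using degree_monic_char_poly[OF M] n by (simp add: constant_degree)
  then obtain l where "poly (char_poly M) l = 0"
    using fundamental_theorem_of_algebra by blast
  then show ?thesis
    using eigenvalue_root_char_poly[OF M, of l] by (auto simp: eigenvalue_def)
qed

lemma unitary_mult:
  assumes "unitary_mat n U" "unitary_mat n V"
  shows "unitary_mat n (U * V)"
proof -
  have U: "U \<in> carrier_mat n n" "mat_adjoint U * U = 1\<^sub>m n" "U * mat_adjoint U = 1\<^sub>m n"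
   and V: "V \<in> carrier_mat n n" "mat_adjoint V * V = 1\<^sub>m n" "V * mat_adjoint V = 1\<^sub>m n"
    using assms by (auto simp: unitary_mat_def)
  have "mat_adjoint V * mat_adjoint U * (U * V) = mat_adjoint V * ((mat_adjoint U * U) * V)"
    using U(1) V(1) by (simp add: mult_mat_assoc)
  also have "\<dots> = 1\<^sub>m n" using U V by simp
  finally have 1: "mat_adjoint V * mat_adjoint U * (U * V) = 1\<^sub>m n" .
  have "(U * V) * (mat_adjoint V * mat_adjoint U) = U * ((V * mat_adjoint V) * mat_adjoint U)"
    using U(1) V(1) by (simp add: mult_mat_assoc)
  also have "\<dots> = U * (1\<^sub>m n * mat_adjoint U)" using V by simp
  also have "\<dots> = 1\<^sub>m n" using U by (simp add: left_mult_one_mat[of _ n n])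
  finally have 2: "(U * V) * (mat_adjoint V * mat_adjoint U) = 1\<^sub>m n" .
  show ?thesis using 1 2 U V by (simp add: unitary_mat_def mat_adjoint_mult[of U n n V n])
qed

definition bordered :: "complex \<Rightarrow> complex mat \<Rightarrow> complex mat" where
  "bordered l X = four_block_mat (mat 1 1 (\<lambda>_. l)) (0\<^sub>m 1 (dim_col X)) (0\<^sub>m (dim_row X) 1) X"

lemma bordered_carrier [simp]: "X \<in> carrier_mat n n \<Longrightarrow> bordered l X \<in> carrier_mat (Suc n) (Suc n)"
  unfolding bordered_def using four_block_carrier_mat[of "mat 1 1 (\<lambda>_. l)" 1 1 X n n] by simp

lemma bordered_mult:
  assumes "X \<in> carrier_mat n n" "Y \<in> carrier_mat n n"
  shows "bordered a X * bordered b Y = bordered (a * b) (X * Y)"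
proof -
  have "mat 1 1 (\<lambda>_. a) * mat 1 1 (\<lambda>_. b) = mat 1 1 (\<lambda>_. a * b)"
    by (rule eq_matI) (auto simp: scalar_prod_def)
  then show ?thesis
    using assms by (auto simp: bordered_def mult_four_block_mat[of _ 1 1 _ n _ n _ _ 1 _ n])
qed

lemma bordered_adjoint: "X \<in> carrier_mat n n \<Longrightarrow> mat_adjoint (bordered a X) = bordered (cnj a) (mat_adjoint X)"
  by (rule eq_matI) (auto simp: bordered_def)

lemma bordered_one: "bordered 1 (1\<^sub>m n) = 1\<^sub>m (Suc n)"
  by (rule eq_matI) (auto simp: bordered_def)

lemma bordered_diag: "bordered a (mat_diag n d) = mat_diag (Suc n) (case_nat a d)"
  by (rule eq_matI) (auto simp: bordered_def mat_diag_def split: nat.split)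

lemma unitary_bordered: "unitary_mat n U \<Longrightarrow> unitary_mat (Suc n) (bordered 1 U)"
  using bordered_mult[of U n "mat_adjoint U" 1 1] bordered_mult[of "mat_adjoint U" n U 1 1]
  by (auto simp: unitary_mat_def bordered_adjoint bordered_one)

text \<open>Deflation: if \<open>e\<^sub>0\<close> is an eigenvector, self-adjointness clears the first row as well as the first
column and makes the corner entry real.\<close>
lemma bordered_hermitian:
  assumes M: "M \<in> carrier_mat (Suc n) (Suc n)" and adj: "mat_adjoint M = M"
    and col0: "\<And>i. i < n \<Longrightarrow> M $$ (Suc i, 0) = 0"
  shows "\<exists>X a. X \<in> carrier_mat n n \<and> mat_adjoint X = X \<and> M = bordered (complex_of_real a) X"
proof -
  have sym: "M $$ (i, j) = cnj (M $$ (j, i))" if "i \<le> n" "j \<le> n" for i j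
    using mat_adjoint_index[of i M j] that M adj by simp
  define X where "X = mat n n (\<lambda>(i, j). M $$ (Suc i, Suc j))"
  have "M $$ (0, 0) = complex_of_real (Re (M $$ (0, 0)))"
    using sym[of 0 0] by (simp add: complex_eq_iff)
  moreover have "M $$ (0, Suc j) = 0" if "j < n" for j
    using sym[of 0 "Suc j"] col0[OF that] that by simp
  ultimately have "M = bordered (complex_of_real (Re (M $$ (0, 0)))) X"
    using M col0 by (intro eq_matI) (auto simp: bordered_def X_def less_Suc_eq_0_disj)
  moreover have "mat_adjoint X = X"
    by (rule eq_matI) (auto simp: X_def sym[symmetric])
  ultimately show ?thesis by (intro exI[of _ X]) (auto simp: X_def)
qed

text \<open>Induction on the dimension. An eigenvector, normalised and multiplied by a phase that makes its first
entry real, is moved to \<open>e\<^sub>0\<close> by a Householder reflection \<open>H\<close>; then \<open>H M H\<close> is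
bordered and the induction hypothesis diagonalises the remaining block.\<close>
theorem hermitian_spectral:
  assumes "M \<in> carrier_mat n n" "mat_adjoint M = M"
  shows "\<exists>U d. unitary_mat n U \<and> M = U * mat_diag n (\<lambda>i. complex_of_real (d i)) * mat_adjoint U"
  using assms
proof (induction n arbitrary: M)
  case 0
  then show ?case
    by (intro exI[of _ "1\<^sub>m 0"] exI[of _ "\<lambda>_. 0"]) (auto simp: unitary_mat_def intro!: eq_matI)
next
  case (Suc n)
  note M = Suc.prems
  obtain v0 l where ev: "eigenvector M v0 l" using ex_eigenvector[OF M(1)] by auto
  then have v0: "v0 \<in> carrier_vec (Suc n)" "v0 \<noteq> 0\<^sub>v (Suc n)" "M *\<^sub>v v0 = l \<cdot>\<^sub>v v0"
    using M by (auto simp: eigenvector_def)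
  obtain c where c: "l2_norm_vec (c \<cdot>\<^sub>v v0) = 1" using ex_unit_multiple v0 by blast
  define a where "a = c * v0 $ 0"
  define z where "z = (if a = 0 then 1 else cnj a / cmod a)"
  define v where "v = (z * c) \<cdot>\<^sub>v v0"
  have "cmod z = 1" by (auto simp: z_def norm_divide norm_mult)
  then have nv: "l2_norm_vec v = 1"
    using c by (simp add: v_def l2_norm_vec_smult norm_mult)
  have v: "v \<in> carrier_vec (Suc n)" using v0 by (simp add: v_def)
  have Mv: "M *\<^sub>v v = l \<cdot>\<^sub>v v"
    using M v0 by (simp add: v_def mult_mat_vec_smult smult_smult_assoc mult.commute)
  have "z * a = complex_of_real (cmod a)"
    using complex_norm_square[of a] by (auto simp: z_def power2_eq_square field_simps)
  then have "v $ 0 = complex_of_real (cmod a)" using v0 by (simp add: v_def a_def mult.assoc)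
  then obtain H where H: "unitary_mat (Suc n) H" "mat_adjoint H = H" "col H 0 = v"
    using ex_unitary_col0[OF v nv] by auto
  have Hc: "H \<in> carrier_mat (Suc n) (Suc n)" and HH: "H * H = 1\<^sub>m (Suc n)"
    using H by (auto simp: unitary_mat_def)
  define N where "N = H * M * H"
  have Nc: "N \<in> carrier_mat (Suc n) (Suc n)" using Hc M by (simp add: N_def)
  have Nadj: "mat_adjoint N = N"
    using Hc M H(2) by (simp add: N_def mat_adjoint_mult[of _ "Suc n" "Suc n" _ "Suc n"] mult_mat_assoc)
  have "col N 0 = l \<cdot>\<^sub>v col (1\<^sub>m (Suc n)) 0"
  proof -
    have He: "H *\<^sub>v v = col (1\<^sub>m (Suc n)) 0"
      using Hc H(3) col_mult2[of H "Suc n" "Suc n" H "Suc n" 0] HH by auto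
    have "col N 0 = H * M *\<^sub>v v"
      using Hc M H(3) by (subst N_def, subst col_mult2[of _ "Suc n" "Suc n" _ "Suc n"]) auto
    also have "\<dots> = l \<cdot>\<^sub>v (H *\<^sub>v v)"
      using Hc M v Mv by (simp add: mult_mat_vec_assoc mult_mat_vec_smult)
    finally show ?thesis using He by simp
  qed
  then have "N $$ (Suc i, 0) = 0" if "i < n" for i
    using that Nc by (auto simp: vec_eq_iff dest!: spec[of _ "Suc i"])
  then obtain X a where X: "X \<in> carrier_mat n n" "mat_adjoint X = X" "N = bordered (complex_of_real a) X"
    using bordered_hermitian[OF Nc Nadj] by blast
  obtain U d where U: "unitary_mat n U" and XU: "X = U * mat_diag n (\<lambda>i. complex_of_real (d i)) * mat_adjoint U"
    using Suc.IH[OF X(1,2)] by blast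
  have Uc: "U \<in> carrier_mat n n" using U by (simp add: unitary_mat_def)
  define D where "D = mat_diag n (\<lambda>i. complex_of_real (d i))"
  define B where "B = bordered 1 U"
  define E where "E = bordered (complex_of_real a) D"
  have Dc: "D \<in> carrier_mat n n" by (simp add: D_def)
  have Bc: "B \<in> carrier_mat (Suc n) (Suc n)" using Uc by (simp add: B_def)
  have Ec: "E \<in> carrier_mat (Suc n) (Suc n)" using Dc by (simp add: E_def)
  have NB: "N = B * E * mat_adjoint B"
    using Uc Dc by (simp add: X(3) XU B_def E_def bordered_adjoint bordered_mult[of _ n] flip: D_def)
  have "M = H * (N * H)"
  proof -
    have "H * (N * H) = (H * H) * M * (H * H)"
      using Hc M by (simp add: N_def mult_mat_assoc)
    then show ?thesis using HH M by simp
  qed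
  also have "\<dots> = (H * B) * E * mat_adjoint (H * B)"
    using Hc Bc Ec H(2) by (simp add: NB mat_adjoint_mult[of _ "Suc n" "Suc n" _ "Suc n"] mult_mat_assoc)
  finally have "M = (H * B) * E * mat_adjoint (H * B)" .
  moreover have "E = mat_diag (Suc n) (\<lambda>i. complex_of_real (case_nat a d i))"
    by (auto simp: E_def D_def bordered_diag intro!: arg_cong[of _ _ "mat_diag _"] split: nat.split)
  moreover have "unitary_mat (Suc n) (H * B)"
    using unitary_mult[OF H(1) unitary_bordered[OF U]] by (simp add: B_def)
  ultimately show ?case by blast
qed

section \<open>Extreme eigenvalues and Rayleigh quotients\<close>

lemma mat_diag_mult_vec:
  "v \<in> carrier_vec n \<Longrightarrow> mat_diag n d *\<^sub>v v = vec n (\<lambda>i. d i * v $ i)"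
  by (rule eq_vecI) (auto simp: mat_diag_def scalar_prod_def if_distrib[of "\<lambda>x. x * _"] cong: if_cong)

lemma spectral_rayleigh:
  assumes U: "unitary_mat n U" and M: "M = U * mat_diag n (\<lambda>i. complex_of_real (d i)) * mat_adjoint U"
    and v: "v \<in> carrier_vec n"
  shows "Re ((M *\<^sub>v v) \<bullet>c v) = (\<Sum>i<n. d i * (cmod ((mat_adjoint U *\<^sub>v v) $ i))\<^sup>2)"
    and "(l2_norm_vec v)\<^sup>2 = (\<Sum>i<n. (cmod ((mat_adjoint U *\<^sub>v v) $ i))\<^sup>2)"
proof -
  define y where "y = mat_adjoint U *\<^sub>v v"
  have Uc: "U \<in> carrier_mat n n" and UU: "U * mat_adjoint U = 1\<^sub>m n"
    using U by (auto simp: unitary_mat_def)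
  have y: "y \<in> carrier_vec n" using Uc by (auto simp: y_def intro!: carrier_vecI)
  let ?D = "mat_diag n (\<lambda>i. complex_of_real (d i))"
  have Dc: "?D \<in> carrier_mat n n" by simp
  have Dy: "?D *\<^sub>v y \<in> carrier_vec n" using mult_mat_vec_carrier[OF Dc y] .
  have "M *\<^sub>v v = U *\<^sub>v (?D *\<^sub>v y)"
    using Uc v Dc y by (simp add: M y_def mult_mat_vec_assoc mat_diag_def)
  then have "(M *\<^sub>v v) \<bullet>c v = (?D *\<^sub>v y) \<bullet>c y"
    using inner_adjoint[OF Uc Dy v] by (simp add: y_def)
  also have "\<dots> = (\<Sum>i<n. complex_of_real (d i * (cmod (y $ i))\<^sup>2))"
    using y by (simp add: mat_diag_mult_vec scalar_prod_def atLeast0LessThan mult.assoc complex_norm_square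
        del: of_real_power)
  finally show "Re ((M *\<^sub>v v) \<bullet>c v) = (\<Sum>i<n. d i * (cmod ((mat_adjoint U *\<^sub>v v) $ i))\<^sup>2)"
    by (simp add: y_def)
  have "l2_norm_vec v = l2_norm_vec y"
    unfolding y_def by (rule sym, rule l2_norm_vec_isometry[of _ n n]) (use Uc UU v in auto)
  moreover have "(l2_norm_vec y)\<^sup>2 = (\<Sum>i<n. (cmod (y $ i))\<^sup>2)"
    using y by (simp add: l2_norm_vec_def L2_set_def sum_nonneg atLeast0LessThan)
  ultimately show "(l2_norm_vec v)\<^sup>2 = (\<Sum>i<n. (cmod ((mat_adjoint U *\<^sub>v v) $ i))\<^sup>2)"
    unfolding y_def by simp
qed

lemma spectral_eigenvalue_iff:
  assumes U: "unitary_mat n U" and M: "M = U * mat_diag n (\<lambda>i. complex_of_real (d i)) * mat_adjoint U"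
  shows "{x. eigenvalue M (complex_of_real x)} = d ` {..<n}"
proof -
  have Uc: "U \<in> carrier_mat n n" and UU: "U * mat_adjoint U = 1\<^sub>m n" "mat_adjoint U * U = 1\<^sub>m n"
    using U by (auto simp: unitary_mat_def)
  let ?D = "mat_diag n (\<lambda>i. complex_of_real (d i))"
  have Dc: "?D \<in> carrier_mat n n" by simp
  have Mc: "M \<in> carrier_mat n n" using Uc Dc by (auto simp: M intro!: carrier_matI)
  have "similar_mat_wit M ?D U (mat_adjoint U)"
    using Uc UU Mc by (intro similar_mat_witI[of _ _ n]) (auto simp: M)
  then have "char_poly M = char_poly ?D"
    by (intro char_poly_similar) (auto simp: similar_mat_def)
  also have "char_poly ?D = (\<Prod>a\<leftarrow>diag_mat ?D. [:- a, 1:])"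
    by (rule char_poly_upper_triangular[of _ n]) (auto simp: mat_diag_def)
  also have "diag_mat ?D = map (\<lambda>i. complex_of_real (d i)) [0..<n]"
    by (auto simp: diag_mat_def mat_diag_def)
  finally have "char_poly M = (\<Prod>i<n. [:- complex_of_real (d i), 1:])"
    by (simp add: prod.list_conv_set_nth atLeast0LessThan)
  then show ?thesis
    using eigenvalue_root_char_poly[OF Mc] by (auto simp: poly_prod)
qed

text \<open>In the coordinates \<open>y = U\<^sup>H v\<close> of an eigenbasis the quadratic form is a weighted sum of the
\<open>|y\<^sub>i|\<^sup>2\<close>, with the eigenvalues as weights. Finiteness and nonemptiness of the set of real
eigenvalues give \<open>Max\<close> and \<open>Min\<close> in \<open>lambda_max\<close> and \<open>lambda_min\<close> their meaning.\<close>
lemma hermitian_eigenvalues: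
  assumes M: "M \<in> carrier_mat n n" "mat_adjoint M = M"
  shows finite_real_eigenvalues: "finite {x. eigenvalue M (complex_of_real x)}"
    and real_eigenvalues_nonempty: "n > 0 \<Longrightarrow> {x. eigenvalue M (complex_of_real x)} \<noteq> {}"
    and rayleigh_le_lambda_max:
      "v \<in> carrier_vec n \<Longrightarrow> Re ((M *\<^sub>v v) \<bullet>c v) \<le> lambda_max M * (l2_norm_vec v)\<^sup>2"
    and lambda_min_le_rayleigh:
      "v \<in> carrier_vec n \<Longrightarrow> lambda_min M * (l2_norm_vec v)\<^sup>2 \<le> Re ((M *\<^sub>v v) \<bullet>c v)"
proof -
  obtain U d where U: "unitary_mat n U"
    and MU: "M = U * mat_diag n (\<lambda>i. complex_of_real (d i)) * mat_adjoint U"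
    using hermitian_spectral[OF M] by blast
  note ev = spectral_eigenvalue_iff[OF U MU]
  show "finite {x. eigenvalue M (complex_of_real x)}" by (simp add: ev)
  show "{x. eigenvalue M (complex_of_real x)} \<noteq> {}" if "n > 0" using that by (auto simp: ev)
  have mx: "d i \<le> lambda_max M" and mn: "lambda_min M \<le> d i" if "i < n" for i
    using that by (auto simp: lambda_max_def lambda_min_def ev)
  assume v: "v \<in> carrier_vec n"
  note ray = spectral_rayleigh[OF U MU v]
  show "Re ((M *\<^sub>v v) \<bullet>c v) \<le> lambda_max M * (l2_norm_vec v)\<^sup>2"
    by (simp only: ray sum_distrib_left) (auto intro!: sum_mono mult_right_mono mx)
  show "lambda_min M * (l2_norm_vec v)\<^sup>2 \<le> Re ((M *\<^sub>v v) \<bullet>c v)"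
    by (simp only: ray sum_distrib_left) (auto intro!: sum_mono mult_right_mono mn)
qed

lemma real_eigenvalue_rayleigh:
  assumes M: "M \<in> carrier_mat n n" and ev: "eigenvalue M (complex_of_real x)"
  shows "\<exists>v \<in> carrier_vec n. l2_norm_vec v = 1 \<and> M *\<^sub>v v = complex_of_real x \<cdot>\<^sub>v v \<and> Re ((M *\<^sub>v v) \<bullet>c v) = x"
proof -
  obtain w where w: "w \<in> carrier_vec n" "w \<noteq> 0\<^sub>v n" "M *\<^sub>v w = complex_of_real x \<cdot>\<^sub>v w"
    using ev M by (auto simp: eigenvalue_def eigenvector_def)
  obtain c where c: "l2_norm_vec (c \<cdot>\<^sub>v w) = 1" using ex_unit_multiple w by blast
  define v where "v = c \<cdot>\<^sub>v w"
  have v: "v \<in> carrier_vec n" "l2_norm_vec v = 1" using w c by (auto simp: v_def)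
  have Mv: "M *\<^sub>v v = complex_of_real x \<cdot>\<^sub>v v"
    using w M by (simp add: v_def mult_mat_vec_smult smult_smult_assoc mult.commute)
  then have "Re ((M *\<^sub>v v) \<bullet>c v) = x" using v by (simp add: inner_self)
  with v Mv show ?thesis by blast
qed

lemma lambda_attained:
  assumes M: "M \<in> carrier_mat n n" "mat_adjoint M = M" and n: "n > 0"
  shows lambda_max_attained: "\<exists>v \<in> carrier_vec n. l2_norm_vec v = 1 \<and> Re ((M *\<^sub>v v) \<bullet>c v) = lambda_max M"
    and lambda_min_attained: "\<exists>v \<in> carrier_vec n. l2_norm_vec v = 1 \<and> Re ((M *\<^sub>v v) \<bullet>c v) = lambda_min M"
proof -
  note f = finite_real_eigenvalues[OF M] real_eigenvalues_nonempty[OF M n]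
  show "\<exists>v \<in> carrier_vec n. l2_norm_vec v = 1 \<and> Re ((M *\<^sub>v v) \<bullet>c v) = lambda_max M"
    using real_eigenvalue_rayleigh[OF M(1)] Max_in[OF f] unfolding lambda_max_def by blast
  show "\<exists>v \<in> carrier_vec n. l2_norm_vec v = 1 \<and> Re ((M *\<^sub>v v) \<bullet>c v) = lambda_min M"
    using real_eigenvalue_rayleigh[OF M(1)] Min_in[OF f] unfolding lambda_min_def by blast
qed

text \<open>The largest eigenvalue of \<open>M\<^sup>H M\<close> bounds the squared operator norm. The maximum with \<open>0\<close>
covers matrices without columns, where \<open>lambda_max\<close> is the maximum of the empty set.\<close>
lemma ex_operator_bound:
  assumes M: "M \<in> carrier_mat n m"
  shows "\<exists>c\<ge>0. \<forall>v\<in>carrier_vec m. l2_norm_vec (M *\<^sub>v v) \<le> c * l2_norm_vec v"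
proof (intro exI conjI ballI)
  let ?c = "sqrt (max 0 (lambda_max (mat_adjoint M * M)))"
  show "?c \<ge> 0" by simp
  fix v :: "complex vec" assume v: "v \<in> carrier_vec m"
  have "(l2_norm_vec (M *\<^sub>v v))\<^sup>2 \<le> lambda_max (mat_adjoint M * M) * (l2_norm_vec v)\<^sup>2"
    using rayleigh_le_lambda_max[OF mult_carrier_mat[OF mat_adjoint_carrier[OF M] M] _ v] M
    by (simp add: l2_norm_vec_mult_adjoint[OF M v] mat_adjoint_mult[of _ m n _ m])
  also have "\<dots> \<le> (?c * l2_norm_vec v)\<^sup>2"
    by (simp add: power_mult_distrib mult_right_mono)
  finally show "l2_norm_vec (M *\<^sub>v v) \<le> ?c * l2_norm_vec v"
    by (rule power2_le_imp_le) simp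
qed

section \<open>Square roots of Hermitian positive definite matrices\<close>

lemma hpd_matD:
  assumes "hpd_mat M" "M \<in> carrier_mat n n"
  shows "mat_adjoint M = M"
    and "v \<in> carrier_vec n \<Longrightarrow> v \<noteq> 0\<^sub>v n \<Longrightarrow> 0 < Re ((M *\<^sub>v v) \<bullet>c v)"
  using assms by (auto simp: hpd_mat_def hermitian_mat_def)

lemma hpd_matI:
  assumes "M \<in> carrier_mat n n" "mat_adjoint M = M"
    and "\<And>v. v \<in> carrier_vec n \<Longrightarrow> v \<noteq> 0\<^sub>v n \<Longrightarrow> 0 < Re ((M *\<^sub>v v) \<bullet>c v)"
  shows "hpd_mat M"
  using assms by (auto simp: hpd_mat_def hermitian_mat_def)

lemma hpd_lambda_min_pos:
  assumes "hpd_mat M" "M \<in> carrier_mat n n" "n > 0"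
  shows "0 < lambda_min M"
proof -
  obtain v where "v \<in> carrier_vec n" "l2_norm_vec v = 1" "Re ((M *\<^sub>v v) \<bullet>c v) = lambda_min M"
    using lambda_min_attained[of M n] hpd_matD(1)[of M n] assms by blast
  then show ?thesis using hpd_matD(2)[of M n v] assms by force
qed

lemma hpd_sqrt_ex:
  assumes M: "hpd_mat M" "M \<in> carrier_mat n n"
  shows "\<exists>R. hpd_mat R \<and> R \<in> carrier_mat n n \<and> R * R = M"
proof -
  obtain U d where U: "unitary_mat n U"
    and MU: "M = U * mat_diag n (\<lambda>i. complex_of_real (d i)) * mat_adjoint U"
    using hermitian_spectral[OF M(2) hpd_matD(1)[OF M]] by blast
  have Uc: "U \<in> carrier_mat n n" and UU: "U * mat_adjoint U = 1\<^sub>m n" "mat_adjoint U * U = 1\<^sub>m n"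
    using U by (auto simp: unitary_mat_def)
  have pos: "d i > 0" if "i < n" for i
  proof -
    have "eigenvalue M (complex_of_real (d i))"
      using spectral_eigenvalue_iff[OF U MU] that by blast
    then obtain v where "v \<in> carrier_vec n" "l2_norm_vec v = 1" "Re ((M *\<^sub>v v) \<bullet>c v) = d i"
      using real_eigenvalue_rayleigh[OF M(2)] by blast
    then show ?thesis using hpd_matD(2)[OF M, of v] by force
  qed
  define D where "D = mat_diag n (\<lambda>i. complex_of_real (sqrt (d i)))"
  define R where "R = U * D * mat_adjoint U"
  have Dc: "D \<in> carrier_mat n n" by (simp add: D_def)
  have Rc: "R \<in> carrier_mat n n" using Uc Dc by (auto simp: R_def intro!: carrier_matI)
  have "D * D = mat_diag n (\<lambda>i. complex_of_real (d i))"
    unfolding D_def mat_diag_diag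
    using pos by (auto simp: mat_diag_def less_imp_le simp flip: of_real_mult intro!: eq_matI)
  moreover have "R * R = U * (D * ((mat_adjoint U * U) * D)) * mat_adjoint U"
    using Uc Dc unfolding R_def by (simp add: mult_mat_assoc)
  ultimately have RR: "R * R = M" using UU Dc by (simp add: MU)
  have Radj: "mat_adjoint R = R"
    using Uc Dc by (simp add: R_def mat_adjoint_mult[of _ n n _ n] mult_mat_assoc)
      (simp add: D_def mat_adjoint_diag)
  have "0 < Re ((R *\<^sub>v v) \<bullet>c v)" if v: "v \<in> carrier_vec n" "v \<noteq> 0\<^sub>v n" for v
  proof -
    let ?y = "mat_adjoint U *\<^sub>v v"
    note ray = spectral_rayleigh[OF U R_def[unfolded D_def] v(1)]
    have "(l2_norm_vec v)\<^sup>2 \<noteq> 0" using v l2_norm_vec_eq_0 by auto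
    then obtain i where i: "i < n" "(cmod (?y $ i))\<^sup>2 \<noteq> 0"
      unfolding ray(2) by (meson lessThan_iff sum.neutral)
    then have "0 < (\<Sum>i<n. sqrt (d i) * (cmod (?y $ i))\<^sup>2)"
      using pos by (intro sum_pos2[of _ i]) (auto simp: less_imp_le)
    then show ?thesis by (simp only: ray(1))
  qed
  then show ?thesis using RR Radj Rc by (blast intro: hpd_matI)
qed

text \<open>If \<open>R\<^sup>2 = T\<^sup>2\<close> then \<open>X = R - T\<close> satisfies \<open>R X + X T = 0\<close>. Testing this with an eigenvector
\<open>v\<close> of \<open>X\<close> for the eigenvalue \<open>d\<close> gives \<open>d (v\<^sup>H R v + v\<^sup>H T v) = 0\<close>, so every eigenvalue of the
Hermitian matrix \<open>X\<close> vanishes.\<close>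
lemma hpd_sqrt_unique:
  assumes R: "hpd_mat R" "R \<in> carrier_mat n n" and T: "hpd_mat T" "T \<in> carrier_mat n n"
    and eq: "R * R = T * T"
  shows "R = T"
proof -
  define X where "X = R - T"
  have Xc: "X \<in> carrier_mat n n" using R T by (auto simp: X_def intro!: carrier_matI)
  have Xadj: "mat_adjoint X = X"
  proof -
    have "mat_adjoint R = R" "mat_adjoint T = T" using hpd_matD(1) R T by blast+
    then have "cnj (R $$ (j, i)) = R $$ (i, j)" "cnj (T $$ (j, i)) = T $$ (i, j)" if "i < n" "j < n" for i j
      using that R T mat_adjoint_index[of i R j] mat_adjoint_index[of i T j] by auto
    then show ?thesis using R T by (intro eq_matI) (auto simp: X_def)
  qed
  have "R * X + X * T = 0\<^sub>m n n"
  proof -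
    have "R * X + X * T = (R * R - R * T) + (R * T - T * T)"
      using R T unfolding X_def
      by (simp add: mult_minus_distrib_mat[of _ n n _ n] minus_mult_distrib_mat[of _ n n _ _ n])
    also have "\<dots> = 0\<^sub>m n n" unfolding eq using R T by (intro eq_matI) auto
    finally show ?thesis .
  qed
  obtain U d where U: "unitary_mat n U"
    and XU: "X = U * mat_diag n (\<lambda>i. complex_of_real (d i)) * mat_adjoint U"
    using hermitian_spectral[OF Xc Xadj] by blast
  have "d i = 0" if "i < n" for i
  proof -
    have "eigenvalue X (complex_of_real (d i))"
      using spectral_eigenvalue_iff[OF U XU] that by blast
    then obtain v where v: "v \<in> carrier_vec n" "l2_norm_vec v = 1" "X *\<^sub>v v = complex_of_real (d i) \<cdot>\<^sub>v v"
      using real_eigenvalue_rayleigh[OF Xc] by blast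
    then have v0: "v \<noteq> 0\<^sub>v n" by auto
    have Rv: "R *\<^sub>v v \<in> carrier_vec n" and Tv: "T *\<^sub>v v \<in> carrier_vec n"
      using mult_mat_vec_carrier R T v by blast+
    have "0\<^sub>m n n *\<^sub>v v = 0\<^sub>v n" using v by (intro eq_vecI) auto
    then have "0 = (0\<^sub>m n n *\<^sub>v v) \<bullet>c v" using v by simp
    also have "0\<^sub>m n n *\<^sub>v v = R *\<^sub>v (X *\<^sub>v v) + X *\<^sub>v (T *\<^sub>v v)"
      unfolding \<open>R * X + X * T = 0\<^sub>m n n\<close>[symmetric] using R T Xc v
      by (simp add: add_mult_distrib_mat_vec[of _ n n] mult_mat_vec_assoc)
    also have "\<dots> \<bullet>c v = (R *\<^sub>v (X *\<^sub>v v)) \<bullet>c v + (X *\<^sub>v (T *\<^sub>v v)) \<bullet>c v"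
      using R Xc v by (intro add_scalar_prod_distrib[of _ n]) (auto intro!: carrier_vecI)
    also have "(R *\<^sub>v (X *\<^sub>v v)) \<bullet>c v = complex_of_real (d i) * ((R *\<^sub>v v) \<bullet>c v)"
      using R Rv v by (simp add: mult_mat_vec_smult)
    also have "(X *\<^sub>v (T *\<^sub>v v)) \<bullet>c v = complex_of_real (d i) * ((T *\<^sub>v v) \<bullet>c v)"
      using inner_adjoint[OF Xc Tv v(1)] Tv v by (simp add: Xadj conjugate_smult_vec)
    finally have "0 = Re (complex_of_real (d i) * ((R *\<^sub>v v) \<bullet>c v) + complex_of_real (d i) * ((T *\<^sub>v v) \<bullet>c v))"
      by simp
    then have "d i * (Re ((R *\<^sub>v v) \<bullet>c v) + Re ((T *\<^sub>v v) \<bullet>c v)) = 0"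
      by (simp add: algebra_simps)
    moreover have "Re ((R *\<^sub>v v) \<bullet>c v) > 0" "Re ((T *\<^sub>v v) \<bullet>c v) > 0"
      using hpd_matD(2) R T v(1) v0 by blast+
    ultimately show ?thesis by simp
  qed
  then have "mat_diag n (\<lambda>i. complex_of_real (d i)) = 0\<^sub>m n n"
    by (intro eq_matI) (auto simp: mat_diag_def)
  moreover have "U \<in> carrier_mat n n" using U by (simp add: unitary_mat_def)
  ultimately have "X = 0\<^sub>m n n"
    unfolding XU by (simp add: right_mult_zero_mat[of _ n n] left_mult_zero_mat[of _ n n])
  then have "X $$ (i, j) = 0" if "i < n" "j < n" for i j using that by simp
  then show ?thesis
    using R T by (intro eq_matI) (auto simp: X_def)
qed

lemma mat_sqrt:
  assumes M: "hpd_mat M" "M \<in> carrier_mat n n"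
  shows "hpd_mat (mat_sqrt M)" "mat_sqrt M \<in> carrier_mat n n" "mat_sqrt M * mat_sqrt M = M"
proof -
  have carrier: "R \<in> carrier_mat n n" if "hpd_mat R" "R * R = M" for R
    using that M(2) by (auto simp: hpd_mat_def hermitian_mat_def intro!: carrier_matI)
  have "\<exists>!R. hpd_mat R \<and> R * R = M"
    using hpd_sqrt_ex[OF M] hpd_sqrt_unique carrier by metis
  then have "hpd_mat (mat_sqrt M) \<and> mat_sqrt M * mat_sqrt M = M"
    unfolding mat_sqrt_def by (rule theI')
  then show "hpd_mat (mat_sqrt M)" "mat_sqrt M \<in> carrier_mat n n" "mat_sqrt M * mat_sqrt M = M"
    using carrier by auto
qed

lemma mat_inverse_of_injective:
  fixes R :: "complex mat"
  assumes R: "R \<in> carrier_mat n n" and inj: "\<And>v. v \<in> carrier_vec n \<Longrightarrow> R *\<^sub>v v = 0\<^sub>v n \<Longrightarrow> v = 0\<^sub>v n"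
  shows "the (mat_inverse R) \<in> carrier_mat n n" "R * the (mat_inverse R) = 1\<^sub>m n"
    "the (mat_inverse R) * R = 1\<^sub>m n"
proof -
  have "det R \<noteq> 0" using det_0_iff_vec_prod_zero[OF R] inj by blast
  then have "R \<in> Units (ring_mat TYPE(complex) n ())"
    by (rule det_non_zero_imp_unit[OF R])
  then obtain B where "mat_inverse R = Some B"
    using mat_inverse(1)[OF R, of "()"] by (cases "mat_inverse R") auto
  then show "the (mat_inverse R) \<in> carrier_mat n n" "R * the (mat_inverse R) = 1\<^sub>m n"
    "the (mat_inverse R) * R = 1\<^sub>m n"
    using mat_inverse(2)[OF R] by auto
qed

lemma hpd_injective:
  assumes M: "hpd_mat M" "M \<in> carrier_mat n n" and v: "v \<in> carrier_vec n" "M *\<^sub>v v = 0\<^sub>v n"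
  shows "v = 0\<^sub>v n"
  using hpd_matD(2)[OF M, of v] v by auto

lemma mat_inv_sqrt:
  assumes M: "hpd_mat M" "M \<in> carrier_mat n n"
  shows "mat_inv_sqrt M \<in> carrier_mat n n" "mat_sqrt M * mat_inv_sqrt M = 1\<^sub>m n"
    "mat_inv_sqrt M * mat_sqrt M = 1\<^sub>m n"
  unfolding mat_inv_sqrt_def
  using mat_inverse_of_injective[of "mat_sqrt M" n] hpd_injective mat_sqrt[OF M] by blast+

lemma quadratic_form_mat_sqrt:
  assumes M: "hpd_mat M" "M \<in> carrier_mat n n" and v: "v \<in> carrier_vec n"
  shows "(l2_norm_vec (mat_sqrt M *\<^sub>v v))\<^sup>2 = Re ((M *\<^sub>v v) \<bullet>c v)"
  using l2_norm_vec_mult_adjoint[OF mat_sqrt(2)[OF M] v] mat_sqrt[OF M] hpd_matD(1)[of "mat_sqrt M" n]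
  by simp

section \<open>Blocks of a matrix as compressions\<close>

text \<open>The isometric inclusion of the coordinates in \<open>I\<close>: column \<open>j\<close>, counted from zero,
is the unit vector of the \<open>j\<close>-th smallest element of \<open>I\<close>.\<close>
definition coord_incl :: "nat \<Rightarrow> nat set \<Rightarrow> complex mat" where
  "coord_incl n I = mat n (card I) (\<lambda>(i, j). if i = pick I j then 1 else 0)"

lemma coord_incl_dim [simp]:
  "dim_row (coord_incl n I) = n" "dim_col (coord_incl n I) = card I"
  by (simp_all add: coord_incl_def)

lemma coord_incl_carrier: "coord_incl n I \<in> carrier_mat n (card I)"
  by (rule carrier_matI) simp_all

lemma pick_eq_iff:
  assumes "i < card I" "j < card I"
  shows "pick I i = pick I j \<longleftrightarrow> i = j"
  using assms pick_mono_le by (metis nat_neq_iff)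

lemma pick_less:
  assumes "I \<subseteq> {0..<n}" "i < card I"
  shows "pick I i < n"
  using pick_in_set_le[OF assms(2)] assms(1) by auto

lemma submatrix_coord_incl:
  assumes M: "M \<in> carrier_mat n n" and I: "I \<subseteq> {0..<n}" and J: "J \<subseteq> {0..<n}"
  shows "submatrix M I J = mat_adjoint (coord_incl n I) * M * coord_incl n J"
proof (rule eq_matI)
  have set: "{i. i < n \<and> i \<in> I} = I" "{i. i < n \<and> i \<in> J} = J" using I J by auto
  show "dim_row (submatrix M I J) = dim_row (mat_adjoint (coord_incl n I) * M * coord_incl n J)"
    "dim_col (submatrix M I J) = dim_col (mat_adjoint (coord_incl n I) * M * coord_incl n J)"
    using M set by (auto simp: dim_submatrix)
  fix i j assume "i < dim_row (mat_adjoint (coord_incl n I) * M * coord_incl n J)"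
    "j < dim_col (mat_adjoint (coord_incl n I) * M * coord_incl n J)"
  then have ij: "i < card I" "j < card J" by auto
  note p = pick_less[OF I ij(1)] pick_less[OF J ij(2)]
  have "(mat_adjoint (coord_incl n I) * M) $$ (i, l) = M $$ (pick I i, l)" if "l < n" for l
  proof -
    have "(mat_adjoint (coord_incl n I) * M) $$ (i, l)
        = (\<Sum>k<n. cnj (if k = pick I i then 1 else 0) * M $$ (k, l))"
      using M that ij by (simp add: scalar_prod_def atLeast0LessThan coord_incl_def)
    also have "\<dots> = (\<Sum>k<n. if k = pick I i then M $$ (k, l) else 0)"
      by (intro sum.cong) auto
    also have "\<dots> = M $$ (pick I i, l)" using p by simp
    finally show ?thesis .
  qed
  then have "(mat_adjoint (coord_incl n I) * M * coord_incl n J) $$ (i, j)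
      = (\<Sum>l<n. M $$ (pick I i, l) * (if l = pick J j then 1 else 0))"
    using M ij by (subst index_mult_mat(1))
      (auto simp: scalar_prod_def atLeast0LessThan coord_incl_def simp del: index_mult_mat(1))
  also have "\<dots> = (\<Sum>l<n. if l = pick J j then M $$ (pick I i, l) else 0)"
    by (intro sum.cong) auto
  also have "\<dots> = M $$ (pick I i, pick J j)" using p by simp
  finally show "submatrix M I J $$ (i, j) = (mat_adjoint (coord_incl n I) * M * coord_incl n J) $$ (i, j)"
    using M ij set by (simp add: submatrix_index)
qed

lemma coord_incl_isometry:
  assumes "I \<subseteq> {0..<n}"
  shows "mat_adjoint (coord_incl n I) * coord_incl n I = 1\<^sub>m (card I)"
proof (rule eq_matI)
  fix i j assume "i < dim_row (1\<^sub>m (card I) :: complex mat)" "j < dim_col (1\<^sub>m (card I) :: complex mat)"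
  then have ij: "i < card I" "j < card I" by auto
  have "(mat_adjoint (coord_incl n I) * coord_incl n I) $$ (i, j)
      = (\<Sum>k<n. cnj (if k = pick I i then 1 else 0) * (if k = pick I j then 1 else 0))"
    using ij by (simp add: scalar_prod_def atLeast0LessThan coord_incl_def)
  also have "\<dots> = (\<Sum>k<n. if k = pick I i then if pick I i = pick I j then 1 else 0 else 0)"
    by (intro sum.cong) auto
  finally show "(mat_adjoint (coord_incl n I) * coord_incl n I) $$ (i, j) = 1\<^sub>m (card I) $$ (i, j)"
    using ij pick_less[OF assms] by (simp add: pick_eq_iff)
qed auto

lemma coord_incl_disjoint:
  assumes "I \<inter> J = {}"
  shows "mat_adjoint (coord_incl n I) * coord_incl n J = 0\<^sub>m (card I) (card J)"
proof (rule eq_matI)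
  fix i j assume "i < dim_row (0\<^sub>m (card I) (card J) :: complex mat)" "j < dim_col (0\<^sub>m (card I) (card J) :: complex mat)"
  then have ij: "i < card I" "j < card J" by auto
  have "pick I i \<noteq> pick J j"
    using pick_in_set_le[OF ij(1)] pick_in_set_le[OF ij(2)] assms by auto
  then show "(mat_adjoint (coord_incl n I) * coord_incl n J) $$ (i, j) = 0\<^sub>m (card I) (card J) $$ (i, j)"
    using ij by (auto simp: scalar_prod_def coord_incl_def intro!: sum.neutral)
qed auto

lemma coord_incl_projection:
  assumes "I \<subseteq> {0..<n}"
  shows "coord_incl n I * mat_adjoint (coord_incl n I) = mat_diag n (\<lambda>i. if i \<in> I then 1 else 0)"
proof (rule eq_matI)
  have fin: "finite I" using assms finite_subset by blast
  fix i j assume "i < dim_row (mat_diag n (\<lambda>i. if i \<in> I then 1 else 0 :: complex))"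
    "j < dim_col (mat_diag n (\<lambda>i. if i \<in> I then 1 else 0 :: complex))"
  then have ij: "i < n" "j < n" by (auto simp: mat_diag_def)
  have *: "(coord_incl n I * mat_adjoint (coord_incl n I)) $$ (i, j)
      = (\<Sum>k<card I. if i = pick I k \<and> j = pick I k then 1 else 0)"
    using ij by (auto simp: scalar_prod_def atLeast0LessThan coord_incl_def intro!: sum.cong)
  show "(coord_incl n I * mat_adjoint (coord_incl n I)) $$ (i, j)
      = mat_diag n (\<lambda>i. if i \<in> I then 1 else 0) $$ (i, j)"
  proof (cases "i \<in> I \<and> i = j")
    case True
    define k where "k = card {a \<in> I. a < i}"
    have "i \<in> I" using True by blast
    then have k: "pick I k = i" unfolding k_def by (rule pick_card_in_set)
    have "k < card I"
      unfolding k_def using True fin by (intro psubset_card_mono) auto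
    then have "(\<Sum>l<card I. if i = pick I l \<and> j = pick I l then 1 else 0 :: complex)
        = (\<Sum>l<card I. if l = k then 1 else 0)"
      using True k by (intro sum.cong) (auto simp: pick_eq_iff)
    then show ?thesis using * \<open>i \<in> I\<close> True ij \<open>k < card I\<close> by (simp add: mat_diag_def)
  next
    case False
    then have "(\<Sum>k<card I. if i = pick I k \<and> j = pick I k then 1 else 0 :: complex) = 0"
      using pick_in_set_le by (intro sum.neutral) auto
    then show ?thesis using * False ij by (auto simp: mat_diag_def)
  qed
qed (auto simp: mat_diag_def)

lemma compression_quadratic_form:
  fixes E F M :: "complex mat"
  assumes E: "E \<in> carrier_mat n r" and F: "F \<in> carrier_mat n s" and M: "M \<in> carrier_mat n n"
    and x: "x \<in> carrier_vec s" and y: "y \<in> carrier_vec r"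
  shows "((mat_adjoint E * M * F) *\<^sub>v x) \<bullet>c y = (M *\<^sub>v (F *\<^sub>v x)) \<bullet>c (E *\<^sub>v y)"
proof -
  have *: "M *\<^sub>v (F *\<^sub>v x) \<in> carrier_vec n" using M by (auto intro!: carrier_vecI)
  have "(mat_adjoint E * M * F) *\<^sub>v x = mat_adjoint E *\<^sub>v (M *\<^sub>v (F *\<^sub>v x))"
    using E F M x by (simp add: mult_mat_vec_assoc)
  then show ?thesis
    using inner_adjoint[OF mat_adjoint_carrier[OF E] * y] by simp
qed

lemma hpd_compression:
  assumes K: "hpd_mat K" "K \<in> carrier_mat n n" and E: "E \<in> carrier_mat n r" and iso: "mat_adjoint E * E = 1\<^sub>m r"
  shows "hpd_mat (mat_adjoint E * K * E)"
proof (rule hpd_matI)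
  show "mat_adjoint E * K * E \<in> carrier_mat r r" using E K by (auto intro!: carrier_matI)
  have "mat_adjoint (mat_adjoint E * K * E) = mat_adjoint E * mat_adjoint (mat_adjoint E * K)"
    using E K by (intro mat_adjoint_mult[of _ r n _ r]) (auto intro!: carrier_matI)
  also have "mat_adjoint (mat_adjoint E * K) = K * E"
    using E K by (simp add: mat_adjoint_mult[of _ r n _ n] hpd_matD(1))
  finally show "mat_adjoint (mat_adjoint E * K * E) = mat_adjoint E * K * E"
    using E K by (simp add: mult_mat_assoc)
  fix v :: "complex vec" assume v: "v \<in> carrier_vec r" "v \<noteq> 0\<^sub>v r"
  have "E *\<^sub>v v \<in> carrier_vec n" using E by (auto intro!: carrier_vecI)
  moreover have "E *\<^sub>v v \<noteq> 0\<^sub>v n"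
    using v l2_norm_vec_eq_0[of v r] l2_norm_vec_isometry[OF E iso v(1)] by auto
  ultimately show "0 < Re ((mat_adjoint E * K * E *\<^sub>v v) \<bullet>c v)"
    using hpd_matD(2)[OF K] compression_quadratic_form[OF E E K(2) v(1) v(1)] by simp
qed

lemma zero_mult_vec: "v \<in> carrier_vec c \<Longrightarrow> 0\<^sub>m r c *\<^sub>v v = (0\<^sub>v r :: complex vec)"
  by (rule eq_vecI) auto

text \<open>Two isometries \<open>EC\<close> and \<open>ED\<close> that split the whole space into orthogonal subspaces of dimensions
\<open>p\<close> and \<open>q\<close>. The adjoints of \<open>EC\<close> and \<open>ED\<close> read off the two components of a vector.\<close>
locale orthogonal_splitting =
  fixes n p q :: nat and EC ED :: "complex mat"
  assumes EC: "EC \<in> carrier_mat n p" and ED: "ED \<in> carrier_mat n q"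
    and isoC: "mat_adjoint EC * EC = 1\<^sub>m p" and isoD: "mat_adjoint ED * ED = 1\<^sub>m q"
    and orth: "mat_adjoint EC * ED = 0\<^sub>m p q"
    and total: "EC * mat_adjoint EC + ED * mat_adjoint ED = 1\<^sub>m n"
begin

lemma dims [simp]: "dim_row EC = n" "dim_col EC = p" "dim_row ED = n" "dim_col ED = q"
  using EC ED by auto

lemma proj_C [simp]: "x \<in> carrier_vec p \<Longrightarrow> mat_adjoint EC *\<^sub>v (EC *\<^sub>v x) = x"
  using mult_mat_vec_assoc[of "mat_adjoint EC" EC x] by (simp add: isoC)

lemma proj_D [simp]: "y \<in> carrier_vec q \<Longrightarrow> mat_adjoint ED *\<^sub>v (ED *\<^sub>v y) = y"
  using mult_mat_vec_assoc[of "mat_adjoint ED" ED y] by (simp add: isoD)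

lemma proj_CD [simp]: "y \<in> carrier_vec q \<Longrightarrow> mat_adjoint EC *\<^sub>v (ED *\<^sub>v y) = 0\<^sub>v p"
  using mult_mat_vec_assoc[of "mat_adjoint EC" ED y] by (simp add: orth zero_mult_vec)

lemma proj_DC [simp]:
  assumes "x \<in> carrier_vec p"
  shows "mat_adjoint ED *\<^sub>v (EC *\<^sub>v x) = 0\<^sub>v q"
proof -
  have "mat_adjoint (mat_adjoint EC * ED) = mat_adjoint ED * EC"
    using EC ED by (simp add: mat_adjoint_mult[of _ p n _ q])
  moreover have "mat_adjoint (0\<^sub>m p q :: complex mat) = 0\<^sub>m q p" by (rule eq_matI) auto
  ultimately have "mat_adjoint ED * EC = 0\<^sub>m q p" by (simp add: orth)
  then show ?thesis
    using mult_mat_vec_assoc[of "mat_adjoint ED" EC x] assms by (simp add: zero_mult_vec)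
qed

lemma carriers [simp]:
  "EC *\<^sub>v x \<in> carrier_vec n" "ED *\<^sub>v y \<in> carrier_vec n"
  "mat_adjoint EC *\<^sub>v w \<in> carrier_vec p" "mat_adjoint ED *\<^sub>v w \<in> carrier_vec q"
  by (auto intro!: carrier_vecI)

lemma decompose:
  assumes "w \<in> carrier_vec n"
  shows "w = EC *\<^sub>v (mat_adjoint EC *\<^sub>v w) + ED *\<^sub>v (mat_adjoint ED *\<^sub>v w)"
proof -
  have "w = 1\<^sub>m n *\<^sub>v w" using assms by simp
  also have "\<dots> = EC * mat_adjoint EC *\<^sub>v w + ED * mat_adjoint ED *\<^sub>v w"
    unfolding total[symmetric] using assms EC ED
    by (intro add_mult_distrib_mat_vec[of _ n n]) (auto intro!: carrier_matI)
  finally show ?thesis using assms by (simp add: mult_mat_vec_assoc)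
qed

lemma norm_EC [simp]: "x \<in> carrier_vec p \<Longrightarrow> l2_norm_vec (EC *\<^sub>v x) = l2_norm_vec x"
  by (rule l2_norm_vec_isometry[OF EC isoC])

lemma norm_ED [simp]: "y \<in> carrier_vec q \<Longrightarrow> l2_norm_vec (ED *\<^sub>v y) = l2_norm_vec y"
  by (rule l2_norm_vec_isometry[OF ED isoD])

lemma norm_decompose:
  assumes w: "w \<in> carrier_vec n"
  shows "(l2_norm_vec w)\<^sup>2 = (l2_norm_vec (mat_adjoint EC *\<^sub>v w))\<^sup>2 + (l2_norm_vec (mat_adjoint ED *\<^sub>v w))\<^sup>2"
proof -
  let ?x = "mat_adjoint EC *\<^sub>v w" and ?y = "mat_adjoint ED *\<^sub>v w"
  have "w \<bullet>c w = (EC *\<^sub>v ?x + ED *\<^sub>v ?y) \<bullet>c w" 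
    by (rule arg_cong[OF decompose[OF w]])
  also have "\<dots> = (EC *\<^sub>v ?x) \<bullet>c w + (ED *\<^sub>v ?y) \<bullet>c w"
    using w by (intro add_scalar_prod_distrib[of _ n]) auto
  also have "\<dots> = ?x \<bullet>c ?x + ?y \<bullet>c ?y"
    using w by (simp add: inner_adjoint[OF EC] inner_adjoint[OF ED])
  finally show ?thesis by (simp add: l2_norm_vec_sq)
qed

lemma norm_proj_le:
  assumes "w \<in> carrier_vec n"
  shows "l2_norm_vec (mat_adjoint EC *\<^sub>v w) \<le> l2_norm_vec w" "l2_norm_vec (mat_adjoint ED *\<^sub>v w) \<le> l2_norm_vec w"
  using norm_decompose[OF assms] by (simp_all add: power2_le_imp_le[OF _ l2_norm_vec_nonneg])

end

lemma inverse_hermitian: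
  fixes R X :: "complex mat"
  assumes R: "R \<in> carrier_mat n n" "mat_adjoint R = R" and X: "X \<in> carrier_mat n n" "R * X = 1\<^sub>m n"
  shows "mat_adjoint X = X"
proof -
  have XR: "mat_adjoint X * R = 1\<^sub>m n"
    using arg_cong[OF X(2), of mat_adjoint] R X(1) by (simp add: mat_adjoint_mult[of _ n n _ n])
  have "mat_adjoint X = mat_adjoint X * (R * X)" using X by simp
  also have "\<dots> = (mat_adjoint X * R) * X" using R X(1) by (simp add: mult_mat_assoc)
  finally show ?thesis using XR X(1) by simp
qed

section \<open>Coupling of the two components\<close>

text \<open>Minimising over \<open>a\<close> the lower bound \<open>a\<^sup>2 + b\<^sup>2 - 2 r a b\<close> leaves \<open>(1 - r\<^sup>2) b\<^sup>2\<close>. Here \<open>z\<close> is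
the cross term of a quadratic form whose two blocks have energies \<open>a\<^sup>2\<close> and \<open>b\<^sup>2\<close>.\<close>
lemma schur_complement_scalar_bound:
  assumes "Re z \<ge> - (r * a * b)" "0 \<le> r"
  shows "(1 - r\<^sup>2) * b\<^sup>2 \<le> a\<^sup>2 + b\<^sup>2 + 2 * Re z"
proof -
  have "0 \<le> (a - r * b)\<^sup>2" by simp
  also have "\<dots> = a\<^sup>2 + b\<^sup>2 - 2 * (r * a * b) - (1 - r\<^sup>2) * b\<^sup>2"
    by (simp add: power2_eq_square algebra_simps)
  finally show ?thesis using assms(1) by linarith
qed

context orthogonal_splitting
begin

lemma quadratic_form_split:
  assumes K: "K \<in> carrier_mat n n" "mat_adjoint K = K" and a: "a \<in> carrier_vec n" and b: "b \<in> carrier_vec n"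
  shows "Re ((K *\<^sub>v (a + b)) \<bullet>c (a + b)) = Re ((K *\<^sub>v a) \<bullet>c a) + Re ((K *\<^sub>v b) \<bullet>c b) + 2 * Re ((K *\<^sub>v b) \<bullet>c a)"
proof -
  have c: "K *\<^sub>v a \<in> carrier_vec n" "K *\<^sub>v b \<in> carrier_vec n" using K(1) a b by (auto intro!: carrier_vecI)
  have "(K *\<^sub>v (a + b)) \<bullet>c (a + b) = (K *\<^sub>v a + K *\<^sub>v b) \<bullet> (conjugate a + conjugate b)"
    using K(1) a b by (simp add: mult_mat_vec_add conjugate_add_vec[of _ n])
  also have "\<dots> = (K *\<^sub>v a) \<bullet>c a + (K *\<^sub>v a) \<bullet>c b + ((K *\<^sub>v b) \<bullet>c a + (K *\<^sub>v b) \<bullet>c b)"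
    using a b c by (simp add: add_scalar_prod_distrib[of _ n] scalar_prod_add_distrib[of _ n])
  also have "(K *\<^sub>v a) \<bullet>c b = cnj ((K *\<^sub>v b) \<bullet>c a)"
    using inner_adjoint[OF K(1) a b] inner_commute[OF a c(2)] K(2) by simp
  finally show ?thesis by simp
qed

lemma n_pos:
  assumes q: "q > 0"
  shows "n > 0"
proof (rule ccontr)
  assume "\<not> n > 0"
  then have "l2_norm_vec (ED *\<^sub>v unit_vec q 0) = 0" by (simp add: l2_norm_vec_def)
  then have "unit_vec q 0 = (0\<^sub>v q :: complex vec)"
    using norm_ED[of "unit_vec q 0"] l2_norm_vec_eq_0[of "unit_vec q 0" q] by simp
  then have "unit_vec q 0 $ 0 = (0 :: complex)" using q by simp
  then show False using q by simp
qed

text \<open>Put \<open>u = KC\<^sup>1\<^sup>/\<^sup>2 x\<close>, \<open>z = KD\<^sup>1\<^sup>/\<^sup>2 y\<close> and let \<open>B\<close> be the matrix whose norm is \<open>rho\<close>. In these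
variables the quadratic form of \<open>K\<close> at the vector with components \<open>x\<close> and \<open>y\<close> is
\<open>|u|\<^sup>2 + |z|\<^sup>2 + 2 Re (u\<^sup>H B z)\<close>. The choice \<open>u = - B z\<close> turns it into \<open>|z|\<^sup>2 - |B z|\<^sup>2\<close>, and since the form is
bounded below by a positive multiple of \<open>|z|\<^sup>2\<close>, the norm of \<open>B\<close> is strictly less than one. The
last claim follows from \<open>|B z| \<le> rho |z|\<close> by completing the square in \<open>|u|\<close>.\<close>
lemma block_contraction:
  assumes K: "hpd_mat K" "K \<in> carrier_mat n n" and q: "q > 0"
  defines "KC \<equiv> mat_adjoint EC * K * EC" and "KD \<equiv> mat_adjoint ED * K * ED"
    and "KCD \<equiv> mat_adjoint EC * K * ED"
  defines "rho \<equiv> spectral_norm (mat_inv_sqrt KC * KCD * mat_inv_sqrt KD)"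
  shows "0 \<le> rho" "rho < 1"
    and "w \<in> carrier_vec n \<Longrightarrow> (1 - rho\<^sup>2) * Re ((K *\<^sub>v (ED *\<^sub>v (mat_adjoint ED *\<^sub>v w))) \<bullet>c (ED *\<^sub>v (mat_adjoint ED *\<^sub>v w)))
      \<le> Re ((K *\<^sub>v w) \<bullet>c w)"
proof -
  have KCh: "hpd_mat KC" and KDh: "hpd_mat KD"
    using hpd_compression[OF K EC isoC] hpd_compression[OF K ED isoD] by (auto simp: KC_def KD_def)
  have KCc: "KC \<in> carrier_mat p p" and KDc: "KD \<in> carrier_mat q q" and KCDc: "KCD \<in> carrier_mat p q"
    by (auto simp: KC_def KD_def KCD_def intro!: carrier_matI)
  define RC where "RC = mat_sqrt KC"
  define RD where "RD = mat_sqrt KD"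
  define XC where "XC = mat_inv_sqrt KC"
  define XD where "XD = mat_inv_sqrt KD"
  note RC = mat_sqrt[OF KCh KCc, folded RC_def] and RD = mat_sqrt[OF KDh KDc, folded RD_def]
  note XC = mat_inv_sqrt[OF KCh KCc, folded RC_def XC_def] and XD = mat_inv_sqrt[OF KDh KDc, folded RD_def XD_def]
  have XCadj: "mat_adjoint XC = XC"
    using inverse_hermitian[OF RC(2) hpd_matD(1)[OF RC(1,2)] XC(1,2)] .
  define B where "B = XC * KCD * XD"
  have Bc: "B \<in> carrier_mat p q" using XC(1) XD(1) by (auto simp: B_def intro!: carrier_matI)
  have rho: "rho = spectral_norm B" by (simp add: rho_def B_def XC_def XD_def)
  have formC: "Re ((K *\<^sub>v (EC *\<^sub>v x)) \<bullet>c (EC *\<^sub>v x)) = (l2_norm_vec (RC *\<^sub>v x))\<^sup>2" if "x \<in> carrier_vec p" for x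
    using quadratic_form_mat_sqrt[OF KCh KCc that] compression_quadratic_form[OF EC EC K(2) that that]
    by (simp add: RC_def KC_def)
  have formD: "Re ((K *\<^sub>v (ED *\<^sub>v y)) \<bullet>c (ED *\<^sub>v y)) = (l2_norm_vec (RD *\<^sub>v y))\<^sup>2" if "y \<in> carrier_vec q" for y
    using quadratic_form_mat_sqrt[OF KDh KDc that] compression_quadratic_form[OF ED ED K(2) that that]
    by (simp add: RD_def KD_def)
  have cross: "(K *\<^sub>v (ED *\<^sub>v y)) \<bullet>c (EC *\<^sub>v x) = (B *\<^sub>v (RD *\<^sub>v y)) \<bullet>c (RC *\<^sub>v x)"
    if x: "x \<in> carrier_vec p" and y: "y \<in> carrier_vec q" for x y
  proof -
    have RCx: "RC *\<^sub>v x \<in> carrier_vec p" and KCDy: "KCD *\<^sub>v y \<in> carrier_vec p"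
      using RC(2) KCDc by (auto intro!: carrier_vecI)
    have X1: "XD *\<^sub>v (RD *\<^sub>v y) = y" "XC *\<^sub>v (RC *\<^sub>v x) = x"
      using mult_mat_vec_assoc[of XD RD y] mult_mat_vec_assoc[of XC RC x] x y XC XD RC(2) RD(2) by auto
    have "B *\<^sub>v (RD *\<^sub>v y) = XC *\<^sub>v (KCD *\<^sub>v (XD *\<^sub>v (RD *\<^sub>v y)))"
      using XC(1) KCDc XD(1) RD(2) y by (simp add: B_def mult_mat_vec_assoc)
    then have "B *\<^sub>v (RD *\<^sub>v y) = XC *\<^sub>v (KCD *\<^sub>v y)" by (simp add: X1)
    then have "(B *\<^sub>v (RD *\<^sub>v y)) \<bullet>c (RC *\<^sub>v x) = (KCD *\<^sub>v y) \<bullet>c x"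
      using inner_adjoint[OF XC(1) KCDy RCx] by (simp add: XCadj X1)
    also have "\<dots> = (K *\<^sub>v (ED *\<^sub>v y)) \<bullet>c (EC *\<^sub>v x)"
      unfolding KCD_def by (rule compression_quadratic_form[OF EC ED K(2) y x])
    finally show ?thesis by simp
  qed
  have form: "Re ((K *\<^sub>v (EC *\<^sub>v x + ED *\<^sub>v y)) \<bullet>c (EC *\<^sub>v x + ED *\<^sub>v y))
      = (l2_norm_vec (RC *\<^sub>v x))\<^sup>2 + (l2_norm_vec (RD *\<^sub>v y))\<^sup>2 + 2 * Re ((B *\<^sub>v (RD *\<^sub>v y)) \<bullet>c (RC *\<^sub>v x))"
    if "x \<in> carrier_vec p" "y \<in> carrier_vec q" for x y
    using quadratic_form_split[OF K(2) hpd_matD(1)[OF K], of "EC *\<^sub>v x" "ED *\<^sub>v y"] that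
    by (simp add: formC formD cross)
  obtain c where c: "c \<ge> 0" "\<And>y. y \<in> carrier_vec q \<Longrightarrow> l2_norm_vec (RD *\<^sub>v y) \<le> c * l2_norm_vec y"
    using ex_operator_bound[OF RD(2)] by blast
  have n: "n > 0" by (rule n_pos[OF q])
  define m where "m = lambda_min K"
  have m: "m > 0" using hpd_lambda_min_pos[OF K n] by (simp add: m_def)
  \<comment> \<open>the gap in \<open>|B z|\<^sup>2 \<le> (1 - e) |z|\<^sup>2\<close>; one is added to \<open>c\<close> only to divide by a positive number\<close>
  define e where "e = m / (c + 1)\<^sup>2"
  have e: "e > 0" using m c(1) by (simp add: e_def)
  have contr: "(l2_norm_vec (B *\<^sub>v z))\<^sup>2 \<le> (1 - e) * (l2_norm_vec z)\<^sup>2" if z: "z \<in> carrier_vec q" for z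
  proof -
    define y where "y = XD *\<^sub>v z"
    \<comment> \<open>the first component that minimises the form for the given \<open>z\<close>\<close>
    define x where "x = XC *\<^sub>v (- (B *\<^sub>v z))"
    have xy: "x \<in> carrier_vec p" "y \<in> carrier_vec q"
      using XC(1) XD(1) by (auto simp: x_def y_def intro!: carrier_vecI)
    have RDy: "RD *\<^sub>v y = z"
      using mult_mat_vec_assoc[of RD XD z] z XD RD(2) by (auto simp: y_def)
    have Bz: "B *\<^sub>v z \<in> carrier_vec p" using Bc z by (auto intro!: carrier_vecI)
    have RCx: "RC *\<^sub>v x = - (B *\<^sub>v z)"
      using mult_mat_vec_assoc[of RC XC "- (B *\<^sub>v z)"] XC RC(2) Bz Bc by (auto simp: x_def)
    have neg: "(B *\<^sub>v z) \<bullet>c (- (B *\<^sub>v z)) = - ((B *\<^sub>v z) \<bullet>c (B *\<^sub>v z))"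
      by (simp flip: uminus_conjugate_vec)
    have neg2: "l2_norm_vec (- (B *\<^sub>v z)) = l2_norm_vec (B *\<^sub>v z)"
      by (simp add: l2_norm_vec_def cong: L2_set_cong_simp)
    have "m * (l2_norm_vec y)\<^sup>2 \<le> m * (l2_norm_vec (EC *\<^sub>v x + ED *\<^sub>v y))\<^sup>2"
      using norm_decompose[of "EC *\<^sub>v x + ED *\<^sub>v y"] xy m by (simp add: mult_mat_vec_add)
    also have "\<dots> \<le> Re ((K *\<^sub>v (EC *\<^sub>v x + ED *\<^sub>v y)) \<bullet>c (EC *\<^sub>v x + ED *\<^sub>v y))"
      unfolding m_def by (rule lambda_min_le_rayleigh[OF K(2) hpd_matD(1)[OF K]]) simp
    also have "\<dots> = (l2_norm_vec z)\<^sup>2 - (l2_norm_vec (B *\<^sub>v z))\<^sup>2"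
      unfolding form[OF xy] RDy RCx neg neg2 by (simp add: l2_norm_vec_sq)
    finally have 1: "(l2_norm_vec (B *\<^sub>v z))\<^sup>2 \<le> (l2_norm_vec z)\<^sup>2 - m * (l2_norm_vec y)\<^sup>2" by simp
    have "l2_norm_vec z \<le> (c + 1) * l2_norm_vec y"
      using add_increasing2[OF l2_norm_vec_nonneg[of y] c(2)[OF xy(2)]] unfolding RDy by (simp add: algebra_simps)
    then have "(l2_norm_vec z)\<^sup>2 \<le> ((c + 1) * l2_norm_vec y)\<^sup>2" by (rule power_mono) simp
    then have "e * (l2_norm_vec z)\<^sup>2 \<le> e * ((c + 1) * l2_norm_vec y)\<^sup>2" using e by (intro mult_left_mono) auto
    also have "\<dots> = m * (l2_norm_vec y)\<^sup>2" using c(1) by (simp add: e_def power_mult_distrib)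
    finally show ?thesis using 1 by (simp add: algebra_simps)
  qed
  let ?N = "{l2_norm_vec (B *\<^sub>v v) | v. v \<in> carrier_vec (dim_col B) \<and> l2_norm_vec v = 1}"
  have N: "?N = {l2_norm_vec (B *\<^sub>v v) | v. v \<in> carrier_vec q \<and> l2_norm_vec v = 1}" using Bc by auto
  have rho_Sup: "rho = Sup ?N" by (simp add: rho spectral_norm_def)
  have ub: "a \<le> sqrt (1 - e)" if "a \<in> ?N" for a
  proof -
    have "a\<^sup>2 \<le> 1 - e" using that contr unfolding N by fastforce
    then show ?thesis by (rule real_le_rsqrt)
  qed
  have ne: "?N \<noteq> {}"
  proof -
    have "unit_vec q 0 \<noteq> (0\<^sub>v q :: complex vec)"
      using q by (metis index_unit_vec(1) index_zero_vec(1) zero_neq_one)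
    then obtain a where "l2_norm_vec (a \<cdot>\<^sub>v unit_vec q 0) = 1"
      using ex_unit_multiple[of "unit_vec q 0" q] by auto
    then show ?thesis unfolding N by fastforce
  qed
  then obtain a where a: "a \<in> ?N" by blast
  have bdd: "bdd_above ?N" using ub by (auto simp: bdd_above_def)
  show "0 \<le> rho"
    unfolding rho_Sup using a by (intro cSup_upper2[OF _ _ bdd, of a]) auto
  show rho1: "rho < 1"
  proof -
    have "rho \<le> sqrt (1 - e)" unfolding rho_Sup using ne ub by (rule cSup_least)
    also have "\<dots> < 1" using e by simp
    finally show ?thesis .
  qed
  have Bz: "l2_norm_vec (B *\<^sub>v z) \<le> rho * l2_norm_vec z" if z: "z \<in> carrier_vec q" for z
  proof (cases "z = 0\<^sub>v q")
    case True
    then show ?thesis using contr[OF z] by simp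
  next
    case False
    then obtain k where k: "l2_norm_vec (k \<cdot>\<^sub>v z) = 1" "k \<noteq> 0" using ex_unit_multiple z by blast
    have "l2_norm_vec (B *\<^sub>v (k \<cdot>\<^sub>v z)) \<le> rho"
      unfolding rho_Sup using k z by (intro cSup_upper[OF _ bdd], unfold N) force
    then have "cmod k * l2_norm_vec (B *\<^sub>v z) \<le> rho"
      using Bc z by (simp add: mult_mat_vec_smult l2_norm_vec_smult)
    also have "\<dots> = cmod k * (rho * l2_norm_vec z)" using k(1) by (simp add: l2_norm_vec_smult mult_ac)
    finally show ?thesis using k(2) by simp
  qed
  show "(1 - rho\<^sup>2) * Re ((K *\<^sub>v (ED *\<^sub>v (mat_adjoint ED *\<^sub>v w))) \<bullet>c (ED *\<^sub>v (mat_adjoint ED *\<^sub>v w)))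
      \<le> Re ((K *\<^sub>v w) \<bullet>c w)" if w: "w \<in> carrier_vec n"
  proof -
    define x where "x = mat_adjoint EC *\<^sub>v w"
    define y where "y = mat_adjoint ED *\<^sub>v w"
    have xy: "x \<in> carrier_vec p" "y \<in> carrier_vec q" by (simp_all add: x_def y_def)
    have RDy: "RD *\<^sub>v y \<in> carrier_vec q" and RCx: "RC *\<^sub>v x \<in> carrier_vec p"
      using RC(2) RD(2) by (auto intro!: carrier_vecI)
    have BRD: "B *\<^sub>v (RD *\<^sub>v y) \<in> carrier_vec p" using Bc by (auto intro!: carrier_vecI)
    let ?s = "(B *\<^sub>v (RD *\<^sub>v y)) \<bullet>c (RC *\<^sub>v x)"
    have "cmod ?s \<le> l2_norm_vec (B *\<^sub>v (RD *\<^sub>v y)) * l2_norm_vec (RC *\<^sub>v x)"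
      by (rule inner_le_norm[OF BRD RCx])
    also have "\<dots> \<le> rho * l2_norm_vec (RD *\<^sub>v y) * l2_norm_vec (RC *\<^sub>v x)"
      by (intro mult_right_mono Bz RDy) simp
    finally have "Re ?s \<ge> - (rho * l2_norm_vec (RC *\<^sub>v x) * l2_norm_vec (RD *\<^sub>v y))"
      using abs_Re_le_cmod[of ?s] by (simp add: mult_ac)
    from schur_complement_scalar_bound[OF this \<open>0 \<le> rho\<close>]
    have "(1 - rho\<^sup>2) * (l2_norm_vec (RD *\<^sub>v y))\<^sup>2
        \<le> Re ((K *\<^sub>v (EC *\<^sub>v x + ED *\<^sub>v y)) \<bullet>c (EC *\<^sub>v x + ED *\<^sub>v y))"
      by (simp add: form[OF xy])
    also have "EC *\<^sub>v x + ED *\<^sub>v y = w" using decompose[OF w] by (simp add: x_def y_def)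
    finally show ?thesis using formD[OF xy(2)] by (simp add: y_def)
  qed
qed

end

section \<open>Extreme eigenvalues of G\<close>

lemma smult_mat_mult_vec:
  fixes M :: "complex mat"
  shows "dim_vec v = dim_col M \<Longrightarrow> (c \<cdot>\<^sub>m M) *\<^sub>v v = c \<cdot>\<^sub>v (M *\<^sub>v v)"
  by (intro eq_vecI) auto

text \<open>The data of the problem in coordinate-free form: \<open>EC * mat_adjoint EC\<close> is the projection \<open>P\<close>, and
the blocks of \<open>S\<close> and \<open>K\<close> are compressions by \<open>EC\<close> and \<open>ED\<close>.\<close>
locale convection_system = orthogonal_splitting +
  fixes S K :: "complex mat" and xi :: real
  assumes S: "S \<in> carrier_mat n n" and K: "K \<in> carrier_mat n n" and K_hpd: "hpd_mat K"
    and xi: "xi \<noteq> 0" and p: "p > 0" and q: "q > 0"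
    and SD_inv: "invertible_mat (mat_adjoint ED * S * ED)"
begin

definition A :: "real \<Rightarrow> complex mat" where
  "A b = S + (\<i> * complex_of_real b * complex_of_real xi) \<cdot>\<^sub>m (EC * mat_adjoint EC)"

definition G :: "real \<Rightarrow> complex mat" where
  "G b = A b * K * mat_adjoint (A b)"

definition SD :: "complex mat" where "SD = mat_adjoint ED * S * ED"
definition KC :: "complex mat" where "KC = mat_adjoint EC * K * EC"
definition KD :: "complex mat" where "KD = mat_adjoint ED * K * ED"
definition rho :: real where
  "rho = spectral_norm (mat_inv_sqrt KC * (mat_adjoint EC * K * ED) * mat_inv_sqrt KD)"
definition lam :: real where "lam = lambda_max KC"
definition Lam :: real where "Lam = lambda_min (SD * KD * mat_adjoint SD)"

text \<open>The energy norm \<open>sqrt (w\<^sup>H K w)\<close>; through the square root of \<open>K\<close> it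
inherits the triangle inequality of the Euclidean norm.\<close>
definition N :: "complex vec \<Rightarrow> real" where
  "N w = l2_norm_vec (mat_sqrt K *\<^sub>v w)"

lemma system_dims [simp]:
  "dim_row S = n" "dim_col S = n" "dim_row K = n" "dim_col K = n"
  "dim_row (mat_sqrt K) = n" "dim_col (mat_sqrt K) = n" "dim_row SD = q" "dim_col SD = q"
  "dim_row KC = p" "dim_col KC = p" "dim_row KD = q" "dim_col KD = q" "dim_row (A b) = n" "dim_col (A b) = n"
  using S K mat_sqrt(2)[OF K_hpd K] by (auto simp: SD_def KC_def KD_def A_def)

lemma N_nonneg [simp]: "0 \<le> N w" by (simp add: N_def)

lemma N_sq: "w \<in> carrier_vec n \<Longrightarrow> (N w)\<^sup>2 = Re ((K *\<^sub>v w) \<bullet>c w)"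
  using quadratic_form_mat_sqrt[OF K_hpd K] by (simp add: N_def)

lemma N_add: "v \<in> carrier_vec n \<Longrightarrow> w \<in> carrier_vec n \<Longrightarrow> N (v + w) \<le> N v + N w"
  by (auto simp: N_def mult_mat_vec_add intro!: l2_norm_vec_triangle[of _ n] carrier_vecI)

lemma N_smult: "v \<in> carrier_vec n \<Longrightarrow> N (c \<cdot>\<^sub>v v) = cmod c * N v"
  by (simp add: N_def mult_mat_vec_smult l2_norm_vec_smult)

lemma N_add_ge:
  assumes "v \<in> carrier_vec n" "w \<in> carrier_vec n"
  shows "N v - N w \<le> N (v + w)"
proof -
  have "v = (v + w) + (- 1) \<cdot>\<^sub>v w" using assms by (intro eq_vecI) auto
  then have "N v \<le> N (v + w) + N ((- 1) \<cdot>\<^sub>v w)"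
    using N_add[of "v + w" "(- 1) \<cdot>\<^sub>v w"] assms by simp
  then show ?thesis using assms by (simp add: N_smult)
qed

lemma adj_A_mult:
  assumes v: "v \<in> carrier_vec n"
  shows "mat_adjoint (A b) *\<^sub>v v = mat_adjoint S *\<^sub>v v
    + (- (\<i> * complex_of_real (b * xi))) \<cdot>\<^sub>v (EC *\<^sub>v (mat_adjoint EC *\<^sub>v v))"
proof -
  have "mat_adjoint (A b) = mat_adjoint S + (- (\<i> * complex_of_real (b * xi))) \<cdot>\<^sub>m (EC * mat_adjoint EC)"
    unfolding A_def
    by (subst mat_adjoint_add[of _ n n])
      (auto simp: mat_adjoint_smult mat_adjoint_mult[OF EC mat_adjoint_carrier[OF EC]] intro!: carrier_matI)
  moreover have "((- (\<i> * complex_of_real (b * xi))) \<cdot>\<^sub>m (EC * mat_adjoint EC)) *\<^sub>v v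
      = (- (\<i> * complex_of_real (b * xi))) \<cdot>\<^sub>v (EC *\<^sub>v (mat_adjoint EC *\<^sub>v v))"
    using v by (simp add: smult_mat_mult_vec mult_mat_vec_assoc)
  ultimately show ?thesis
    using v by (simp add: add_mult_distrib_mat_vec[of _ n n] carrier_matI)
qed

lemma adj_carrier [simp]: "mat_adjoint (A b) *\<^sub>v v \<in> carrier_vec n" "mat_adjoint S *\<^sub>v v \<in> carrier_vec n"
  by (auto intro!: carrier_vecI)

lemma G_hermitian: "G b \<in> carrier_mat n n" "mat_adjoint (G b) = G b"
proof -
  have Ac: "A b \<in> carrier_mat n n" by (auto intro!: carrier_matI)
  show "G b \<in> carrier_mat n n" by (auto simp: G_def intro!: carrier_matI)
  have AK: "A b * K \<in> carrier_mat n n" by (auto intro!: carrier_matI)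
  show "mat_adjoint (G b) = G b"
    unfolding G_def mat_adjoint_mult[OF AK mat_adjoint_carrier[OF Ac]] mat_adjoint_mult[OF Ac K]
    using hpd_matD(1)[OF K_hpd K] by (simp add: mult_mat_assoc)
qed

lemma G_form:
  assumes "v \<in> carrier_vec n"
  shows "Re ((G b *\<^sub>v v) \<bullet>c v) = (N (mat_adjoint (A b) *\<^sub>v v))\<^sup>2"
proof -
  have "mat_adjoint (A b) \<in> carrier_mat n n" by (auto intro!: carrier_matI)
  from compression_quadratic_form[OF this this K assms assms] show ?thesis
    by (simp add: N_sq G_def)
qed

lemma N_ge: "w \<in> carrier_vec n \<Longrightarrow> sqrt (lambda_min K) * l2_norm_vec w \<le> N w"
  using lambda_min_le_rayleigh[OF K hpd_matD(1)[OF K_hpd K], of w] N_sq[of w]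
    hpd_lambda_min_pos[OF K_hpd K n_pos[OF q]]
  by - (rule power2_le_imp_le, auto simp: power_mult_distrib)

lemma KC_hpd: "hpd_mat KC" "KC \<in> carrier_mat p p"
  using hpd_compression[OF K_hpd K EC isoC] by (auto simp: KC_def intro!: carrier_matI)

lemma KD_hpd: "hpd_mat KD" "KD \<in> carrier_mat q q"
  using hpd_compression[OF K_hpd K ED isoD] by (auto simp: KD_def intro!: carrier_matI)

lemma N_EC_sq: "x \<in> carrier_vec p \<Longrightarrow> (N (EC *\<^sub>v x))\<^sup>2 = Re ((KC *\<^sub>v x) \<bullet>c x)"
  using compression_quadratic_form[OF EC EC K] by (simp add: N_sq KC_def)

lemma lam_attained: "\<exists>x \<in> carrier_vec p. l2_norm_vec x = 1 \<and> N (EC *\<^sub>v x) = sqrt lam"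
proof -
  obtain x where "x \<in> carrier_vec p" "l2_norm_vec x = 1" "Re ((KC *\<^sub>v x) \<bullet>c x) = lam"
    using lambda_max_attained[OF KC_hpd(2) hpd_matD(1)[OF KC_hpd] p] by (auto simp: lam_def)
  then show ?thesis using N_EC_sq[of x] by (metis N_nonneg real_sqrt_unique)
qed

lemma lam_pos: "lam > 0"
proof -
  obtain x where x: "x \<in> carrier_vec p" "l2_norm_vec x = 1" "N (EC *\<^sub>v x) = sqrt lam"
    using lam_attained by blast
  have "0 < sqrt (lambda_min K)" using hpd_lambda_min_pos[OF K_hpd K n_pos[OF q]] by simp
  also have "\<dots> \<le> sqrt lam" using N_ge[of "EC *\<^sub>v x"] x by simp
  finally show ?thesis by simp
qed

lemma N_EC_le: "x \<in> carrier_vec p \<Longrightarrow> N (EC *\<^sub>v x) \<le> sqrt lam * l2_norm_vec x"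
  using rayleigh_le_lambda_max[OF KC_hpd(2) hpd_matD(1)[OF KC_hpd], of x] N_EC_sq[of x] lam_pos
  by - (rule power2_le_imp_le, auto simp: power_mult_distrib lam_def)

lemma SKS_hermitian:
  "SD * KD * mat_adjoint SD \<in> carrier_mat q q" "mat_adjoint (SD * KD * mat_adjoint SD) = SD * KD * mat_adjoint SD"
proof -
  have SDc: "SD \<in> carrier_mat q q" by (auto intro!: carrier_matI)
  show "SD * KD * mat_adjoint SD \<in> carrier_mat q q" by (auto intro!: carrier_matI)
  have c: "SD * KD \<in> carrier_mat q q" by (auto intro!: carrier_matI)
  show "mat_adjoint (SD * KD * mat_adjoint SD) = SD * KD * mat_adjoint SD"
    unfolding mat_adjoint_mult[OF c mat_adjoint_carrier[OF SDc]] mat_adjoint_mult[OF SDc KD_hpd(2)]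
    using hpd_matD(1)[OF KD_hpd] by (simp add: mult_mat_assoc)
qed

lemma SKS_form:
  assumes y: "y \<in> carrier_vec q"
  shows "Re ((SD * KD * mat_adjoint SD *\<^sub>v y) \<bullet>c y) = (N (ED *\<^sub>v (mat_adjoint SD *\<^sub>v y)))\<^sup>2"
proof -
  have c: "mat_adjoint SD \<in> carrier_mat q q" and y': "mat_adjoint SD *\<^sub>v y \<in> carrier_vec q"
    by (auto intro!: carrier_matI carrier_vecI)
  from compression_quadratic_form[OF c c KD_hpd(2) y y] compression_quadratic_form[OF ED ED K y' y'] show ?thesis
    by (simp add: N_sq KD_def)
qed

lemma adj_SD: "y \<in> carrier_vec q \<Longrightarrow> mat_adjoint SD *\<^sub>v y = mat_adjoint ED *\<^sub>v (mat_adjoint S *\<^sub>v (ED *\<^sub>v y))"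
proof -
  assume y: "y \<in> carrier_vec q"
  have c: "mat_adjoint ED * S \<in> carrier_mat q n" by (auto intro!: carrier_matI)
  have "mat_adjoint SD = mat_adjoint ED * (mat_adjoint S * ED)"
    by (simp add: SD_def mat_adjoint_mult[OF c ED] mat_adjoint_mult[OF mat_adjoint_carrier[OF ED] S])
  then show ?thesis using y by (simp add: mult_mat_vec_assoc)
qed

lemma adj_SD_injective:
  assumes y: "y \<in> carrier_vec q" and 0: "mat_adjoint SD *\<^sub>v y = 0\<^sub>v q"
  shows "y = 0\<^sub>v q"
proof -
  obtain B where B: "SD * B = 1\<^sub>m q" "B * SD = 1\<^sub>m (dim_row B)"
    using SD_inv by (auto simp: invertible_mat_def inverts_mat_def SD_def)
  have "dim_col B = q" "dim_row B = q"
    using arg_cong[OF B(1), of dim_col] arg_cong[OF B(2), of dim_col] by auto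
  then have Bc: "B \<in> carrier_mat q q" by auto
  have SDc: "SD \<in> carrier_mat q q" by (auto intro!: carrier_matI)
  have "mat_adjoint B * mat_adjoint SD = 1\<^sub>m q"
    using arg_cong[OF B(1), of mat_adjoint] by (simp add: mat_adjoint_mult[OF SDc Bc])
  then have "y = mat_adjoint B *\<^sub>v (mat_adjoint SD *\<^sub>v y)"
    using mult_mat_vec_assoc[of "mat_adjoint B" "mat_adjoint SD" y] Bc y by simp
  also have "\<dots> = 0\<^sub>v q" unfolding 0 using Bc by (intro eq_vecI) auto
  finally show ?thesis .
qed

lemma Lam_attained: "\<exists>y \<in> carrier_vec q. l2_norm_vec y = 1 \<and> N (ED *\<^sub>v (mat_adjoint SD *\<^sub>v y)) = sqrt Lam"
proof -
  obtain y where "y \<in> carrier_vec q" "l2_norm_vec y = 1" "Re ((SD * KD * mat_adjoint SD *\<^sub>v y) \<bullet>c y) = Lam"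
    using lambda_min_attained[OF SKS_hermitian q] by (auto simp: Lam_def)
  then show ?thesis using SKS_form[of y] by (metis N_nonneg real_sqrt_unique)
qed

lemma Lam_pos: "Lam > 0"
proof -
  obtain y where y: "y \<in> carrier_vec q" "l2_norm_vec y = 1" "N (ED *\<^sub>v (mat_adjoint SD *\<^sub>v y)) = sqrt Lam"
    using Lam_attained by blast
  have c: "mat_adjoint SD *\<^sub>v y \<in> carrier_vec q" by (auto intro!: carrier_vecI)
  have "mat_adjoint SD *\<^sub>v y \<noteq> 0\<^sub>v q" using adj_SD_injective[OF y(1)] y(2) by auto
  then have "0 < l2_norm_vec (mat_adjoint SD *\<^sub>v y)"
    using l2_norm_vec_eq_0[OF c] l2_norm_vec_nonneg[of "mat_adjoint SD *\<^sub>v y"] by linarith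
  then have "0 < sqrt (lambda_min K) * l2_norm_vec (mat_adjoint SD *\<^sub>v y)"
    using hpd_lambda_min_pos[OF K_hpd K n_pos[OF q]] by simp
  also have "\<dots> \<le> sqrt Lam"
    using N_ge[of "ED *\<^sub>v (mat_adjoint SD *\<^sub>v y)"] y(3) c by simp
  finally show ?thesis by simp
qed

lemma N_SD_ge: "y \<in> carrier_vec q \<Longrightarrow> sqrt Lam * l2_norm_vec y \<le> N (ED *\<^sub>v (mat_adjoint SD *\<^sub>v y))"
  using lambda_min_le_rayleigh[OF SKS_hermitian, of y] SKS_form[of y] Lam_pos
  by - (rule power2_le_imp_le, auto simp: power_mult_distrib Lam_def)

lemma rho_bounds: "0 \<le> rho" "rho < 1"
  using block_contraction(1,2)[OF K_hpd K q] by (simp_all add: rho_def KC_def KD_def)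

lemma N_rho:
  assumes "w \<in> carrier_vec n"
  shows "sqrt (1 - rho\<^sup>2) * N (ED *\<^sub>v (mat_adjoint ED *\<^sub>v w)) \<le> N w"
proof (rule power2_le_imp_le)
  have "rho\<^sup>2 \<le> 1" using rho_bounds by (simp add: power_le_one)
  then show "(sqrt (1 - rho\<^sup>2) * N (ED *\<^sub>v (mat_adjoint ED *\<^sub>v w)))\<^sup>2 \<le> (N w)\<^sup>2"
    using block_contraction(3)[OF K_hpd K q assms] assms
    by (simp add: power_mult_distrib N_sq rho_def KC_def KD_def)
qed simp

lemma ex_N_bound:
  assumes "M \<in> carrier_mat n r"
  shows "\<exists>c\<ge>0. \<forall>v\<in>carrier_vec r. N (M *\<^sub>v v) \<le> c * l2_norm_vec v"
proof -
  have "mat_sqrt K * M \<in> carrier_mat n r" using assms by (auto intro!: carrier_matI)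
  from ex_operator_bound[OF this] show ?thesis
    using assms by (auto simp: N_def mult_mat_vec_assoc)
qed

text \<open>The term \<open>b \<xi> P v\<close> of \<open>A(b)\<^sup>H v\<close> has energy norm at most \<open>b |\<xi>| sqrt lam\<close> for unit vectors \<open>v\<close>, with
equality for a top eigenvector of \<open>KC\<close>; the other term is bounded independently of \<open>b\<close>.\<close>
lemma lambda_max_G_bounds:
  "\<exists>c\<ge>0. \<forall>b>0. b * \<bar>xi\<bar> * sqrt lam - c \<le> sqrt (lambda_max (G b)) \<and>
     sqrt (lambda_max (G b)) \<le> b * \<bar>xi\<bar> * sqrt lam + c"
proof -
  obtain s where s: "s \<ge> 0" "\<And>v. v \<in> carrier_vec n \<Longrightarrow> N (mat_adjoint S *\<^sub>v v) \<le> s * l2_norm_vec v"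
    using ex_N_bound[of "mat_adjoint S" n] S by auto
  have "b * \<bar>xi\<bar> * sqrt lam - s \<le> sqrt (lambda_max (G b)) \<and> sqrt (lambda_max (G b)) \<le> b * \<bar>xi\<bar> * sqrt lam + s"
    if b: "b > 0" for b
  proof
    obtain x where x: "x \<in> carrier_vec p" "l2_norm_vec x = 1" "N (EC *\<^sub>v x) = sqrt lam"
      using lam_attained by blast
    let ?v = "EC *\<^sub>v x"
    have "b * \<bar>xi\<bar> * sqrt lam - s \<le> b * \<bar>xi\<bar> * N ?v - N (mat_adjoint S *\<^sub>v ?v)"
      using s(2)[of ?v] x by simp
    also have "\<dots> \<le> N (mat_adjoint (A b) *\<^sub>v ?v)"
    proof -
      let ?u = "(- (\<i> * complex_of_real (b * xi))) \<cdot>\<^sub>v ?v"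
      have "mat_adjoint (A b) *\<^sub>v ?v = ?u + mat_adjoint S *\<^sub>v ?v"
        using x by (simp add: adj_A_mult comm_add_vec[of _ n])
      moreover have "N ?u = b * \<bar>xi\<bar> * N ?v" using b by (simp add: N_smult norm_mult abs_mult)
      ultimately show ?thesis using N_add_ge[of ?u "mat_adjoint S *\<^sub>v ?v"] by simp
    qed
    also have "\<dots> \<le> sqrt (lambda_max (G b))"
      using rayleigh_le_lambda_max[OF G_hermitian, of ?v b] G_form[of ?v b] x
      by - (rule real_le_rsqrt, simp)
    finally show "b * \<bar>xi\<bar> * sqrt lam - s \<le> sqrt (lambda_max (G b))" .
    obtain v where v: "v \<in> carrier_vec n" "l2_norm_vec v = 1" "Re ((G b *\<^sub>v v) \<bullet>c v) = lambda_max (G b)"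
      using lambda_max_attained[OF G_hermitian n_pos[OF q]] by blast
    let ?w = "EC *\<^sub>v (mat_adjoint EC *\<^sub>v v)"
    have "sqrt (lambda_max (G b)) = N (mat_adjoint (A b) *\<^sub>v v)"
      using v G_form[OF v(1), of b] by (simp add: real_sqrt_unique)
    also have "\<dots> \<le> N (mat_adjoint S *\<^sub>v v) + N ((- (\<i> * complex_of_real (b * xi))) \<cdot>\<^sub>v ?w)"
      unfolding adj_A_mult[OF v(1)] by (rule N_add) auto
    also have "\<dots> = N (mat_adjoint S *\<^sub>v v) + b * \<bar>xi\<bar> * N ?w"
      using b by (simp add: N_smult norm_mult abs_mult)
    also have "\<dots> \<le> s + b * \<bar>xi\<bar> * (sqrt lam * 1)"
    proof (intro add_mono mult_left_mono)
      show "N (mat_adjoint S *\<^sub>v v) \<le> s" using s(2)[OF v(1)] v(2) by simp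
      have "N ?w \<le> sqrt lam * l2_norm_vec (mat_adjoint EC *\<^sub>v v)" by (rule N_EC_le) simp
      also have "\<dots> \<le> sqrt lam * 1"
        using norm_proj_le(1)[OF v(1)] v(2) lam_pos by (intro mult_left_mono) auto
      finally show "N ?w \<le> sqrt lam * 1" .
    qed (use b in auto)
    finally show "sqrt (lambda_max (G b)) \<le> b * \<bar>xi\<bar> * sqrt lam + s" by simp
  qed
  then show ?thesis using s(1) by blast
qed

lemma lambda_min_G_sqrt: "\<exists>v \<in> carrier_vec n. l2_norm_vec v = 1 \<and> sqrt (lambda_min (G b)) = N (mat_adjoint (A b) *\<^sub>v v)
   \<and> 0 \<le> lambda_min (G b)"
proof -
  obtain v where v: "v \<in> carrier_vec n" "l2_norm_vec v = 1" "Re ((G b *\<^sub>v v) \<bullet>c v) = lambda_min (G b)"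
    using lambda_min_attained[OF G_hermitian n_pos[OF q]] by blast
  have eq: "lambda_min (G b) = (N (mat_adjoint (A b) *\<^sub>v v))\<^sup>2"
    using v G_form[OF v(1), of b] by simp
  show ?thesis using v by (intro bexI[of _ v]) (auto simp: eq)
qed

text \<open>Test vector: take \<open>y\<close> a unit eigenvector for \<open>Lam\<close> and add a \<open>C\<close> component
\<open>x / (i b \<xi>)\<close> chosen so that \<open>- i b \<xi> P\<close> maps it to minus the \<open>C\<close> component \<open>x\<close> of \<open>S\<^sup>H y\<close>. What
remains of \<open>A(b)\<^sup>H v\<close> is \<open>SD\<^sup>H y\<close>, with energy \<open>Lam\<close>, and a term of order \<open>1/b\<close>. The norm of
the test vector is at least one, which only helps.\<close>
lemma lambda_min_G_upper:
  "\<exists>c\<ge>0. \<forall>b>0. sqrt (lambda_min (G b)) \<le> sqrt Lam + c / b"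
proof -
  obtain s where s: "s \<ge> 0" "\<And>v. v \<in> carrier_vec n \<Longrightarrow> N (mat_adjoint S *\<^sub>v v) \<le> s * l2_norm_vec v"
    using ex_N_bound[of "mat_adjoint S" n] S by auto
  obtain y where y: "y \<in> carrier_vec q" "l2_norm_vec y = 1" "N (ED *\<^sub>v (mat_adjoint SD *\<^sub>v y)) = sqrt Lam"
    using Lam_attained by blast
  define x where "x = mat_adjoint EC *\<^sub>v (mat_adjoint S *\<^sub>v (ED *\<^sub>v y))"
  have x: "x \<in> carrier_vec p" by (simp add: x_def)
  define c where "c = s * l2_norm_vec x / \<bar>xi\<bar>"
  have c: "c \<ge> 0" using s(1) by (simp add: c_def)
  have "sqrt (lambda_min (G b)) \<le> sqrt Lam + c / b" if b: "b > 0" for b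
  proof -
    define t where "t = \<i> * complex_of_real (b * xi)"
    have t: "t \<noteq> 0" "cmod t = b * \<bar>xi\<bar>" using b xi by (auto simp: t_def norm_mult abs_mult)
    define u where "u = (1 / t) \<cdot>\<^sub>v (EC *\<^sub>v x)"
    have u: "u \<in> carrier_vec n" by (simp add: u_def)
    have nu: "l2_norm_vec u = l2_norm_vec x / (b * \<bar>xi\<bar>)"
      using x t by (simp add: u_def l2_norm_vec_smult norm_divide)
    define v where "v = ED *\<^sub>v y + u"
    have v: "v \<in> carrier_vec n" using u by (simp add: v_def)
    have ECv: "EC *\<^sub>v (mat_adjoint EC *\<^sub>v v) = u"
      using x y u by (simp add: v_def u_def mult_mat_vec_add mult_mat_vec_smult)
    have EDv: "mat_adjoint ED *\<^sub>v v = y"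
    proof -
      have "mat_adjoint ED *\<^sub>v v = y + (1 / t) \<cdot>\<^sub>v 0\<^sub>v q"
        using x y u by (simp add: v_def u_def mult_mat_vec_add mult_mat_vec_smult)
      also have "\<dots> = y" using y(1) by (intro eq_vecI) auto
      finally show ?thesis .
    qed
    have "mat_adjoint (A b) *\<^sub>v v = ED *\<^sub>v (mat_adjoint SD *\<^sub>v y) + mat_adjoint S *\<^sub>v u"
    proof -
      have tu: "(- t) \<cdot>\<^sub>v u = - (EC *\<^sub>v x)"
        using t x by (intro eq_vecI) (auto simp: u_def)
      have "mat_adjoint (A b) *\<^sub>v v = (mat_adjoint S *\<^sub>v (ED *\<^sub>v y) + mat_adjoint S *\<^sub>v u) + - (EC *\<^sub>v x)"
        unfolding adj_A_mult[OF v] ECv t_def[symmetric] tu using u by (simp add: v_def mult_mat_vec_add)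
      also have "mat_adjoint S *\<^sub>v (ED *\<^sub>v y) = EC *\<^sub>v x + ED *\<^sub>v (mat_adjoint SD *\<^sub>v y)"
        unfolding adj_SD[OF y(1)] x_def by (rule decompose) simp
      finally show ?thesis using x u by (simp only:) (rule eq_vecI, auto)
    qed
    then have "N (mat_adjoint (A b) *\<^sub>v v) \<le> sqrt Lam + N (mat_adjoint S *\<^sub>v u)"
      using N_add[of "ED *\<^sub>v (mat_adjoint SD *\<^sub>v y)" "mat_adjoint S *\<^sub>v u"] y(3) by simp
    also have "\<dots> \<le> sqrt Lam + c / b"
      using s(2)[OF u] b xi by (simp add: nu c_def field_simps)
    finally have le: "N (mat_adjoint (A b) *\<^sub>v v) \<le> sqrt Lam + c / b" .
    have "0 \<le> lambda_min (G b)" using lambda_min_G_sqrt by blast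
    then have "lambda_min (G b) * 1 \<le> lambda_min (G b) * (l2_norm_vec v)\<^sup>2"
      using norm_decompose[OF v] y(2) by (intro mult_left_mono) (auto simp: EDv)
    also have "\<dots> \<le> (N (mat_adjoint (A b) *\<^sub>v v))\<^sup>2"
      using lambda_min_le_rayleigh[OF G_hermitian v, of b] G_form[OF v, of b] by simp
    also have "\<dots> \<le> (sqrt Lam + c / b)\<^sup>2" using le by (rule power_mono) simp
    finally show ?thesis using Lam_pos c b by - (rule real_le_lsqrt, auto)
  qed
  then show ?thesis using c by blast
qed

text \<open>Let \<open>x\<close> and \<open>y\<close> be the components of a unit eigenvector \<open>v\<close> for the smallest eigenvalue. If
\<open>|x|\<close> exceeds a suitable multiple \<open>d / b\<close> of \<open>1/b\<close>, the term \<open>b \<xi> P v\<close> alone makes the energy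
larger than claimed. Otherwise \<open>|y| \<ge> 1 - O(1/b)\<close>, and discarding the \<open>C\<close> component of \<open>A(b)\<^sup>H v\<close> at
the cost of the factor \<open>sqrt (1 - rho\<^sup>2)\<close> leaves \<open>SD\<^sup>H y\<close> up to \<open>O(|x|)\<close>.\<close>
lemma lambda_min_G_lower:
  "\<exists>c\<ge>0. \<forall>b>0. sqrt (1 - rho\<^sup>2) * (sqrt Lam - c / b) \<le> sqrt (lambda_min (G b))"
proof -
  obtain s where s: "s \<ge> 0" "\<And>v. v \<in> carrier_vec n \<Longrightarrow> N (mat_adjoint S *\<^sub>v v) \<le> s * l2_norm_vec v"
    using ex_N_bound[of "mat_adjoint S" n] S by auto
  have "ED * (mat_adjoint ED * (mat_adjoint S * EC)) \<in> carrier_mat n p" by (auto intro!: carrier_matI)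
  from ex_N_bound[OF this] obtain T where T: "T \<ge> 0"
    "\<And>x. x \<in> carrier_vec p \<Longrightarrow> N (ED *\<^sub>v (mat_adjoint ED *\<^sub>v (mat_adjoint S *\<^sub>v (EC *\<^sub>v x)))) \<le> T * l2_norm_vec x"
    by (auto simp: mult_mat_vec_assoc)
  define r where "r = sqrt (1 - rho\<^sup>2)"
  have "rho\<^sup>2 < 1" using rho_bounds by (simp add: power_less_one_iff abs_square_less_1)
  then have r: "r > 0" by (simp add: r_def)
  define m where "m = sqrt (lambda_min K)"
  have m: "m > 0" using hpd_lambda_min_pos[OF K_hpd K n_pos[OF q]] by (simp add: m_def)
  \<comment> \<open>for \<open>|x| \<ge> d / b\<close> the lower bound \<open>b |\<xi>| m |x| - s\<close> reaches \<open>r sqrt Lam\<close>\<close>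
  define d where "d = (s + r * sqrt Lam) / (\<bar>xi\<bar> * m)"
  define c where "c = (sqrt Lam + T) * d"
  have d: "d \<ge> 0" using s(1) r Lam_pos m by (simp add: d_def)
  have c: "c \<ge> 0" using d T(1) Lam_pos by (simp add: c_def)
  have "r * (sqrt Lam - c / b) \<le> sqrt (lambda_min (G b))" if b: "b > 0" for b
  proof -
    obtain v where v: "v \<in> carrier_vec n" "l2_norm_vec v = 1" "sqrt (lambda_min (G b)) = N (mat_adjoint (A b) *\<^sub>v v)"
      using lambda_min_G_sqrt by blast
    define w where "w = mat_adjoint (A b) *\<^sub>v v"
    define x where "x = mat_adjoint EC *\<^sub>v v"
    define y where "y = mat_adjoint ED *\<^sub>v v"
    have w: "w \<in> carrier_vec n" and x: "x \<in> carrier_vec p" and y: "y \<in> carrier_vec q"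
      by (simp_all add: w_def x_def y_def)
    have vxy: "v = EC *\<^sub>v x + ED *\<^sub>v y" using decompose[OF v(1)] by (simp add: x_def y_def)
    have w_eq: "w = mat_adjoint S *\<^sub>v v + (- (\<i> * complex_of_real (b * xi))) \<cdot>\<^sub>v (EC *\<^sub>v x)"
      using adj_A_mult[OF v(1)] by (simp add: w_def x_def)
    show ?thesis
    proof (cases "l2_norm_vec x \<le> d / b")
      case False
      have "r * (sqrt Lam - c / b) \<le> r * sqrt Lam" using r c b by simp
      also have "\<dots> = b * \<bar>xi\<bar> * (m * (d / b)) - s"
        using b xi m by (simp add: d_def field_simps)
      also have "\<dots> \<le> b * \<bar>xi\<bar> * (m * l2_norm_vec x) - s"
        using False b m by (intro diff_right_mono mult_left_mono) auto
      also have "\<dots> \<le> b * \<bar>xi\<bar> * N (EC *\<^sub>v x) - N (mat_adjoint S *\<^sub>v v)"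
        using N_ge[of "EC *\<^sub>v x"] x s(2)[OF v(1)] v(2) b
        by (intro diff_mono mult_left_mono) (auto simp: m_def)
      also have "b * \<bar>xi\<bar> * N (EC *\<^sub>v x) = N ((- (\<i> * complex_of_real (b * xi))) \<cdot>\<^sub>v (EC *\<^sub>v x))"
        using b by (simp add: N_smult norm_mult abs_mult)
      also have "\<dots> - N (mat_adjoint S *\<^sub>v v) \<le> N w"
        unfolding w_eq
        by (subst comm_add_vec[of _ n], simp, simp, rule N_add_ge, auto)
      finally show ?thesis by (simp add: v(3) w_def)
    next
      case True
      have EDw: "mat_adjoint ED *\<^sub>v w = mat_adjoint SD *\<^sub>v y + mat_adjoint ED *\<^sub>v (mat_adjoint S *\<^sub>v (EC *\<^sub>v x))"
      proof -
        have "mat_adjoint ED *\<^sub>v w = mat_adjoint ED *\<^sub>v (mat_adjoint S *\<^sub>v v)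
            + (- (\<i> * complex_of_real (b * xi))) \<cdot>\<^sub>v 0\<^sub>v q"
          unfolding w_eq using x by (simp add: mult_mat_vec_add mult_mat_vec_smult)
        also have "\<dots> = mat_adjoint ED *\<^sub>v (mat_adjoint S *\<^sub>v v)"
          by (intro eq_vecI) auto
        also have "\<dots> = mat_adjoint ED *\<^sub>v (mat_adjoint S *\<^sub>v (EC *\<^sub>v x)) + mat_adjoint SD *\<^sub>v y"
          using x y by (simp add: vxy mult_mat_vec_add adj_SD)
        finally show ?thesis by (subst comm_add_vec[of _ q]) (auto intro!: carrier_vecI)
      qed
      have "1 \<le> l2_norm_vec x + l2_norm_vec y"
        using l2_norm_vec_triangle[of "EC *\<^sub>v x" n "ED *\<^sub>v y"] x y v(2) by (simp add: vxy)
      then have "sqrt Lam * (1 - l2_norm_vec x) \<le> sqrt Lam * l2_norm_vec y"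
        using Lam_pos by (intro mult_left_mono) auto
      also have "\<dots> \<le> N (ED *\<^sub>v (mat_adjoint SD *\<^sub>v y))" by (rule N_SD_ge[OF y])
      finally have 1: "sqrt Lam - sqrt Lam * l2_norm_vec x \<le> N (ED *\<^sub>v (mat_adjoint SD *\<^sub>v y))"
        by (simp add: algebra_simps)
      have "(sqrt Lam + T) * l2_norm_vec x \<le> (sqrt Lam + T) * (d / b)"
        using True Lam_pos T(1) by (intro mult_left_mono) auto
      then have "sqrt Lam - c / b \<le> N (ED *\<^sub>v (mat_adjoint SD *\<^sub>v y))
          - N (ED *\<^sub>v (mat_adjoint ED *\<^sub>v (mat_adjoint S *\<^sub>v (EC *\<^sub>v x))))"
        using 1 T(2)[OF x] by (simp add: c_def algebra_simps add_divide_distrib)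
      also have "\<dots> \<le> N (ED *\<^sub>v (mat_adjoint ED *\<^sub>v w))"
        unfolding EDw
        by (subst mult_mat_vec_add) (auto intro!: N_add_ge)
      finally have "r * (sqrt Lam - c / b) \<le> r * N (ED *\<^sub>v (mat_adjoint ED *\<^sub>v w))"
        using r by (intro mult_left_mono) auto
      also have "\<dots> \<le> N w" unfolding r_def by (rule N_rho[OF w])
      finally show ?thesis by (simp add: v(3) w_def)
    qed
  qed
  then show ?thesis using c by (auto simp: r_def)
qed

end

section \<open>Asymptotics of the condition number\<close>

text \<open>The two-sided bounds on the square roots of the extreme eigenvalues are squared and divided; the
error functions are the relative errors of the resulting quotients, written out explicitly.\<close>
lemma condition_number_asymptotics:
  fixes L l :: "real \<Rightarrow> real" and lam Lam r x c1 c2 c3 :: real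
  assumes pos: "lam > 0" "Lam > 0" "r > 0" "x > 0" and c: "c1 \<ge> 0" "c2 \<ge> 0" "c3 \<ge> 0"
    and L: "\<And>b. b > 0 \<Longrightarrow> b * x * sqrt lam - c1 \<le> sqrt (L b)"
      "\<And>b. b > 0 \<Longrightarrow> sqrt (L b) \<le> b * x * sqrt lam + c1"
    and l: "\<And>b. b > 0 \<Longrightarrow> r * (sqrt Lam - c3 / b) \<le> sqrt (l b)"
      "\<And>b. b > 0 \<Longrightarrow> sqrt (l b) \<le> sqrt Lam + c2 / b"
  shows "\<exists>e1 e2. (e1 \<longlongrightarrow> 0) at_top \<and> (e2 \<longlongrightarrow> 0) at_top \<and>
    (\<forall>\<^sub>F b in at_top. lam * b\<^sup>2 * x\<^sup>2 / Lam * (1 + e1 b) \<le> L b / l b \<and>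
       L b / l b \<le> lam * b\<^sup>2 * x\<^sup>2 / (r\<^sup>2 * Lam) * (1 + e2 b))"
proof -
  define a where "a = sqrt lam"
  define g where "g = sqrt Lam"
  have ag: "a > 0" "g > 0" "lam = a\<^sup>2" "Lam = g\<^sup>2" using pos by (auto simp: a_def g_def)
  define e1 where "e1 = (\<lambda>b. ((1 - c1 / (x * a * b)) / (1 + c2 / (g * b)))\<^sup>2 - 1)"
  define e2 where "e2 = (\<lambda>b. ((1 + c1 / (x * a * b)) / (1 - c3 / (g * b)))\<^sup>2 - 1)"
  have inv: "((\<lambda>b::real. k / (h * b)) \<longlongrightarrow> 0) at_top" if "h > 0" for k h :: real
    using that by real_asymp
  have "(e1 \<longlongrightarrow> ((1 - 0) / (1 + 0))\<^sup>2 - 1) at_top"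
    unfolding e1_def using ag pos by (intro tendsto_intros inv) auto
  moreover have "(e2 \<longlongrightarrow> ((1 + 0) / (1 - 0))\<^sup>2 - 1) at_top"
    unfolding e2_def using ag pos by (intro tendsto_intros inv) auto
  moreover have "\<forall>\<^sub>F b in at_top. lam * b\<^sup>2 * x\<^sup>2 / Lam * (1 + e1 b) \<le> L b / l b \<and>
       L b / l b \<le> lam * b\<^sup>2 * x\<^sup>2 / (r\<^sup>2 * Lam) * (1 + e2 b)"
    using eventually_gt_at_top[of 0] eventually_gt_at_top[of "c1 / (x * a)"] eventually_gt_at_top[of "c3 / g"]
  proof eventually_elim
    case (elim b)
    have b: "b > 0" by fact
    have p1: "b * x * a - c1 > 0" using elim(2) ag pos by (simp add: field_simps)
    have p2: "g - c3 / b > 0" using elim(3) ag b by (simp add: field_simps)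
    have sL: "sqrt (L b) > 0" using L(1)[OF b] p1 unfolding a_def by linarith
    have sl: "sqrt (l b) > 0"
      using l(1)[OF b] mult_pos_pos[OF pos(3) p2] unfolding g_def by linarith
    have sq: "(sqrt (L b))\<^sup>2 = L b" "(sqrt (l b))\<^sup>2 = l b" using sL sl by auto
    have Lb: "(b * x * a - c1)\<^sup>2 \<le> L b" "L b \<le> (b * x * a + c1)\<^sup>2"
      using power_mono[OF L(1)[OF b], of 2] power_mono[OF L(2)[OF b], of 2] p1 sL by (simp_all add: sq a_def)
    have lb: "(r * (g - c3 / b))\<^sup>2 \<le> l b" "l b \<le> (g + c2 / b)\<^sup>2"
      using power_mono[OF l(1)[OF b], of 2] power_mono[OF l(2)[OF b], of 2] mult_pos_pos[OF pos(3) p2] sl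
      by (simp_all add: sq g_def)
    have p3: "g + c2 / b > 0" using ag b c by (simp add: add_pos_nonneg)
    have p4: "g * b - c3 > 0" using elim(3) ag b by (simp add: field_simps)
    have "lam * b\<^sup>2 * x\<^sup>2 / Lam * (1 + e1 b) = (a * b * x / g * ((1 - c1 / (x * a * b)) / (1 + c2 / (g * b))))\<^sup>2"
      unfolding e1_def by (simp add: ag(3,4) power_mult_distrib power_divide)
    also have "a * b * x / g * ((1 - c1 / (x * a * b)) / (1 + c2 / (g * b))) = (b * x * a - c1) / (g + c2 / b)"
    proof -
      have "a * b * x * (1 - c1 / (x * a * b)) = b * x * a - c1" "g * (1 + c2 / (g * b)) = g + c2 / b"
        using ag pos b by (auto simp: field_simps)
      then show ?thesis by (metis times_divide_times_eq)
    qed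
    also have "((b * x * a - c1) / (g + c2 / b))\<^sup>2 \<le> L b / l b"
      unfolding power_divide using Lb lb sl sL by (intro frac_le) auto
    finally have 1: "lam * b\<^sup>2 * x\<^sup>2 / Lam * (1 + e1 b) \<le> L b / l b" .
    have "L b / l b \<le> ((b * x * a + c1) / (r * (g - c3 / b)))\<^sup>2"
      unfolding power_divide using Lb lb mult_pos_pos[OF pos(3) p2] by (intro frac_le) auto
    also have "(b * x * a + c1) / (r * (g - c3 / b)) = a * b * x / (r * g) * ((1 + c1 / (x * a * b)) / (1 - c3 / (g * b)))"
    proof -
      have "a * b * x * (1 + c1 / (x * a * b)) = b * x * a + c1" "r * g * (1 - c3 / (g * b)) = r * (g - c3 / b)"
        using ag pos b by (auto simp: field_simps)
      then show ?thesis by (metis times_divide_times_eq)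
    qed
    also have "(\<dots>)\<^sup>2 = lam * b\<^sup>2 * x\<^sup>2 / (r\<^sup>2 * Lam) * (1 + e2 b)"
      unfolding e2_def by (simp add: ag(3,4) power_mult_distrib power_divide)
    finally show ?case using 1 by blast
  qed
  ultimately show ?thesis by auto
qed

context convection_system
begin

theorem spectral_cond_G_asymptotics:
  "\<exists>e1 e2. (e1 \<longlongrightarrow> 0) at_top \<and> (e2 \<longlongrightarrow> 0) at_top \<and>
    (\<forall>\<^sub>F b in at_top. lam * b\<^sup>2 * xi\<^sup>2 / Lam * (1 + e1 b) \<le> spectral_cond (G b) \<and>
       spectral_cond (G b) \<le> lam * b\<^sup>2 * xi\<^sup>2 / ((1 - rho\<^sup>2) * Lam) * (1 + e2 b))"
proof -
  have "rho\<^sup>2 < 1" using rho_bounds by (simp add: abs_square_less_1)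
  then have r: "sqrt (1 - rho\<^sup>2) > 0" "(sqrt (1 - rho\<^sup>2))\<^sup>2 = 1 - rho\<^sup>2" by auto
  obtain c1 where c1: "c1 \<ge> 0" "\<And>b. b > 0 \<Longrightarrow> b * \<bar>xi\<bar> * sqrt lam - c1 \<le> sqrt (lambda_max (G b))"
    "\<And>b. b > 0 \<Longrightarrow> sqrt (lambda_max (G b)) \<le> b * \<bar>xi\<bar> * sqrt lam + c1"
    using lambda_max_G_bounds by blast
  obtain c2 where c2: "c2 \<ge> 0" "\<And>b. b > 0 \<Longrightarrow> sqrt (lambda_min (G b)) \<le> sqrt Lam + c2 / b"
    using lambda_min_G_upper by blast
  obtain c3 where c3: "c3 \<ge> 0" "\<And>b. b > 0 \<Longrightarrow> sqrt (1 - rho\<^sup>2) * (sqrt Lam - c3 / b) \<le> sqrt (lambda_min (G b))"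
    using lambda_min_G_lower by blast
  show ?thesis
    using condition_number_asymptotics[OF lam_pos Lam_pos r(1) _ c1(1) c2(1) c3(1) c1(2,3) c3(2) c2(2)] xi
    by (simp add: r(2) spectral_cond_def)
qed

end

lemma lesssim_of_upper_asymptotics:
  fixes X Y e :: "real \<Rightarrow> real"
  assumes e: "(e \<longlongrightarrow> 0) at_top" and k: "k > 0" and Y: "\<And>b. 0 \<le> Y b"
    and le: "\<forall>\<^sub>F b in at_top. X b \<le> k * Y b * (1 + e b)"
  shows "X \<lesssim> Y"
  unfolding lesssim_def
proof (intro exI conjI)
  show "2 * k > 0" using k by simp
  have "\<forall>\<^sub>F b in at_top. e b < 1" using e by (rule order_tendstoD) simp
  with le show "\<forall>\<^sub>F b in at_top. X b \<le> 2 * k * Y b"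
  proof eventually_elim
    case (elim b)
    have "k * Y b * (1 + e b) \<le> k * Y b * 2"
      using elim(2) k Y[of b] by (intro mult_left_mono) auto
    with elim(1) show ?case by simp
  qed
qed

lemma lesssim_of_lower_asymptotics:
  fixes X Y e :: "real \<Rightarrow> real"
  assumes e: "(e \<longlongrightarrow> 0) at_top" and k: "k > 0" and X: "\<And>b. 0 \<le> X b"
    and le: "\<forall>\<^sub>F b in at_top. k * X b * (1 + e b) \<le> Y b"
  shows "X \<lesssim> Y"
  unfolding lesssim_def
proof (intro exI conjI)
  show "2 / k > 0" using k by simp
  have "\<forall>\<^sub>F b in at_top. - (1 / 2) < e b" using e by (rule order_tendstoD) simp
  with le show "\<forall>\<^sub>F b in at_top. X b \<le> 2 / k * Y b"
  proof eventually_elim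
    case (elim b)
    have "k * X b * (1 / 2) \<le> k * X b * (1 + e b)"
      using elim(2) k X[of b] by (intro mult_left_mono) auto
    with elim(1) have "k * X b \<le> 2 * Y b" by simp
    then show ?case using k by (simp add: field_simps)
  qed
qed

theorem corollary5p3:
  fixes n m :: nat
    and C D :: "nat set"
    and S K P :: "complex mat"
    and xi rho Lam eps_D :: real
    and eps :: "nat \<Rightarrow> real"
    and A G :: "real \<Rightarrow> complex mat"
    and Pe :: "real \<Rightarrow> real"
  assumes "n \<ge> 2"
    and "C \<union> D = {0..<n}" and "C \<inter> D = {}"
    and "card C = m" and "m \<ge> 1"
    and "card D = n - m" and "n - m \<ge> 1"
    and "S \<in> carrier_mat n n" and "invertible_mat (submatrix S D D)"
    and "xi \<noteq> 0"
    and "K \<in> carrier_mat n n" and "hpd_mat K"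
    and "\<forall>i<n. eps i > 0"
  defines "P \<equiv> mat_diag n (\<lambda>i. if i \<in> C then 1 else 0)"
    and "A \<equiv> (\<lambda>b. S + (\<i> * complex_of_real b * complex_of_real xi) \<cdot>\<^sub>m P)"
    and "G \<equiv> (\<lambda>b. A b * K * mat_adjoint (A b))"
    and "rho \<equiv> spectral_norm
           (mat_inv_sqrt (submatrix K C C) * submatrix K C D * mat_inv_sqrt (submatrix K D D))"
    and "Lam \<equiv> lambda_min
           (submatrix S D D * submatrix K D D * mat_adjoint (submatrix S D D))"
    and "eps_D \<equiv> Min (eps ` D)"
    and "Pe \<equiv> (\<lambda>b. peclet b eps_D xi)"
  shows "rho < 1
    \<and> (\<exists>e1 e2 :: real \<Rightarrow> real. e1 \<in> o[at_top](\<lambda>_. 1) \<and> e2 \<in> o[at_top](\<lambda>_. 1) \<and>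
        (\<forall>\<^sub>F b in at_top.
           lambda_max (submatrix K C C) * b\<^sup>2 * xi\<^sup>2 / Lam * (1 + e1 b) \<le> spectral_cond (G b) \<and>
           spectral_cond (G b) \<le>
             lambda_max (submatrix K C C) * b\<^sup>2 * xi\<^sup>2 / ((1 - rho\<^sup>2) * Lam) * (1 + e2 b)))
    \<and> (\<lambda>b. (Pe b)\<^sup>2) \<lesssim> (\<lambda>b. spectral_cond (G b))
    \<and> (\<lambda>b. spectral_cond (G b)) \<lesssim> (\<lambda>b. (Pe b)\<^sup>2 / (1 - rho\<^sup>2))"
proof -
  \<comment> \<open>the coordinate inclusions of \<open>C\<close> and \<open>D\<close> instantiate the abstract splitting\<close>
  define EC where "EC = coord_incl n C"
  define ED where "ED = coord_incl n D"
  have CD: "C \<subseteq> {0..<n}" "D \<subseteq> {0..<n}" using assms(2) by auto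
  have fin: "finite C" "finite D" using CD finite_subset by blast+
  note sub = submatrix_coord_incl[OF _ CD(1) CD(1), folded EC_def] submatrix_coord_incl[OF _ CD(1) CD(2), folded EC_def ED_def]
    submatrix_coord_incl[OF _ CD(2) CD(2), folded ED_def]
  note proj = coord_incl_projection[OF CD(1), folded EC_def] coord_incl_projection[OF CD(2), folded ED_def]
  have P: "P = EC * mat_adjoint EC" by (simp add: P_def proj)
  have "mat_diag n (\<lambda>i. if i \<in> C then 1 else 0) + mat_diag n (\<lambda>i. if i \<in> D then 1 else 0) = (1\<^sub>m n :: complex mat)"
    using assms(2,3) by (intro eq_matI) (auto simp: mat_diag_def)
  then have total: "EC * mat_adjoint EC + ED * mat_adjoint ED = 1\<^sub>m n" by (simp add: proj)
  interpret cs: convection_system n "card C" "card D" EC ED S K xi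
  proof unfold_locales
    show "EC \<in> carrier_mat n (card C)" "ED \<in> carrier_mat n (card D)"
      by (simp_all add: EC_def ED_def coord_incl_carrier)
    show "mat_adjoint EC * EC = 1\<^sub>m (card C)" "mat_adjoint ED * ED = 1\<^sub>m (card D)"
      by (simp_all add: EC_def ED_def coord_incl_isometry CD)
    show "mat_adjoint EC * ED = 0\<^sub>m (card C) (card D)"
      by (simp add: EC_def ED_def coord_incl_disjoint assms(3))
    show "invertible_mat (mat_adjoint ED * S * ED)" using assms(8,9) by (simp add: sub)
  qed (use assms total in auto)
  have A: "A = cs.A" by (rule ext) (simp add: A_def cs.A_def P)
  have G: "G = cs.G" by (rule ext) (simp add: G_def cs.G_def A)
  have rho: "rho = cs.rho"
    using assms(11) by (simp add: rho_def cs.rho_def cs.KC_def cs.KD_def sub)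
  have Lam: "Lam = cs.Lam"
    using assms(8,11) by (simp add: Lam_def cs.Lam_def cs.SD_def cs.KD_def sub)
  have lam: "lambda_max (submatrix K C C) = cs.lam"
    using assms(11) by (simp add: cs.lam_def cs.KC_def sub)
  obtain e1 e2 :: "real \<Rightarrow> real" where e: "(e1 \<longlongrightarrow> 0) at_top" "(e2 \<longlongrightarrow> 0) at_top"
    and bounds: "\<forall>\<^sub>F b in at_top.
        lambda_max (submatrix K C C) * b\<^sup>2 * xi\<^sup>2 / Lam * (1 + e1 b) \<le> spectral_cond (G b) \<and>
        spectral_cond (G b) \<le> lambda_max (submatrix K C C) * b\<^sup>2 * xi\<^sup>2 / ((1 - rho\<^sup>2) * Lam) * (1 + e2 b)"
    using cs.spectral_cond_G_asymptotics unfolding lam Lam G rho by blast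
  have pos: "cs.lam > 0" "Lam > 0" using cs.lam_pos cs.Lam_pos by (simp_all add: Lam)
  have rho1: "rho < 1" "1 - rho\<^sup>2 > 0"
    using cs.rho_bounds by (simp_all add: rho abs_square_less_1)
  have "D \<noteq> {}" using assms(6,7) by auto
  then have "eps_D \<in> eps ` D" unfolding eps_D_def using fin by (intro Min_in) auto
  then have eps: "eps_D > 0" using CD(2) assms(13) by auto
  have Pe: "(Pe b)\<^sup>2 * (eps_D\<^sup>2 * xi\<^sup>2) = b\<^sup>2" for b
    using eps assms(10) by (simp add: Pe_def peclet_def power_divide power_mult_distrib)
  \<comment> \<open>the factor between the leading term \<open>lam b\<^sup>2 \<xi>\<^sup>2 / Lam\<close> and \<open>Pe\<^sup>2\<close>\<close>
  define k where "k = cs.lam * (eps_D\<^sup>2 * xi\<^sup>2) * xi\<^sup>2 / Lam"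
  have k: "k > 0" using pos eps assms(10) by (simp add: k_def)
  have kPe: "k * (Pe b)\<^sup>2 = lambda_max (submatrix K C C) * b\<^sup>2 * xi\<^sup>2 / Lam" for b
    unfolding Pe[of b, symmetric] by (simp add: k_def lam)
  have "\<forall>\<^sub>F b in at_top. k * (Pe b)\<^sup>2 * (1 + e1 b) \<le> spectral_cond (G b)"
    using bounds by eventually_elim (simp add: kPe)
  then have "(\<lambda>b. (Pe b)\<^sup>2) \<lesssim> (\<lambda>b. spectral_cond (G b))"
    by (rule lesssim_of_lower_asymptotics[OF e(1) k, rotated]) simp
  moreover have "\<forall>\<^sub>F b in at_top. spectral_cond (G b) \<le> k * ((Pe b)\<^sup>2 / (1 - rho\<^sup>2)) * (1 + e2 b)"
    using bounds
  proof eventually_elim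
    case (elim b)
    have "k * ((Pe b)\<^sup>2 / (1 - rho\<^sup>2)) = lambda_max (submatrix K C C) * b\<^sup>2 * xi\<^sup>2 / ((1 - rho\<^sup>2) * Lam)"
      using kPe[of b] by (simp add: field_simps)
    with elim show ?case by simp
  qed
  then have "(\<lambda>b. spectral_cond (G b)) \<lesssim> (\<lambda>b. (Pe b)\<^sup>2 / (1 - rho\<^sup>2))"
    by (rule lesssim_of_upper_asymptotics[OF e(2) k, rotated]) (use rho1 in simp)
  moreover have "e1 \<in> o[at_top](\<lambda>_. 1)" "e2 \<in> o[at_top](\<lambda>_. 1)"
    using e by (auto intro!: smalloI_tendsto)
  ultimately show ?thesis using bounds rho1(1) by blast
qed

end
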